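(* Let $A$ be a JB-algebra and let $a,b\in A$ be arbitrary. Then the following are equivalent. (a) $a$ and $b$ operator commute. (b) The JB-algebra generated by $a$ and $b$ is associative. (c) The JB-algebra generated by $a$ and $b$ is associative and consists of mutually operator commuting elements (i.e. any two of its elements operator commute in $A$). (d) Each of $a$ and $a^2$ operator commutes with each of $b$ and $b^2$. If moreover at least one of $a$ and $b$ is positive, then these statements are furthermore equivalent to $Q_a b^2 = Q_b a^2$.
   Context: A (unital) Jordan algebra over a field of characteristic different from 2 is a vector space $E$ with a bilinear, commutative, unital (not necessarily associative) product $*$ satisfying $(a*b)*(a*a)=a*(b*(a*a))$ for all $a,b$. Write $a^2:=a*a$, $T_a:E\to E$, $T_a(b):=a*b$, and $Q_a:=2T_a^2-T_{a^2}$ (the quadratic map of $a$). Elements $a,b\in E$ operator commute when $T_aT_b=T_bT_a$ as operators on $E$. A JB-algebra is a real Jordan algebra $(A,*,1)$ that is also a Banach space with norm satisfying, for all $a,b\in A$: $\|a*b\|\le\|a\|\|b\|$, $\|a^2\|=\|a\|^2$, and $\|a^2\|\le\|a^2+b^2\|$. All JB-algebras are unital. An element $a\in A$ is positive ($a\ge 0$) when $a=c^2$ for some $c\in A$. The JB-algebra generated by $a$ and $b$ is the smallest norm-closed Jordan subalgebra of $A$ containing $a$, $b$ and $1$. It is associative when $*$ restricted to it is associative. *)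

theory Defs
  imports "HOL-Analysis.Analysis"
begin

text \<open>
  Real unital Jordan algebras. The underlying vector space is a whole type; the product and the
  unit are parameters, so that several products may be considered on the same space.
\<close>

locale jordan_algebra =
  fixes jmult :: "'a::real_vector \<Rightarrow> 'a \<Rightarrow> 'a"  (infixl \<open>\<star>\<close> 70)
    and unit :: 'a
  assumes bilinear_jmult: "bilinear (\<star>)"
    and jmult_commute: "a \<star> b = b \<star> a"
    and unit_left: "unit \<star> a = a"
    and jordan_identity: "(a \<star> b) \<star> (a \<star> a) = a \<star> (b \<star> (a \<star> a))"

text \<open>
  As usual, the zero algebra is not excluded, so \<open>norm unit = 1\<close> is not required.
\<close>

locale jb_algebra = jordan_algebra jmult unit
  for jmult :: "'a::banach \<Rightarrow> 'a \<Rightarrow> 'a"  (infixl \<open>\<star>\<close> 70)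
    and unit :: 'a +
  assumes norm_jmult_le: "norm (a \<star> b) \<le> norm a * norm b"
    and norm_square: "norm (a \<star> a) = (norm a)\<^sup>2"
    and norm_square_le_add: "norm (a \<star> a) \<le> norm (a \<star> a + b \<star> b)"

definition jordan_T :: "('a \<Rightarrow> 'a \<Rightarrow> 'a) \<Rightarrow> 'a \<Rightarrow> 'a \<Rightarrow> 'a"
  where "jordan_T m a = (\<lambda>b. m a b)"

definition jordan_Q :: "('a::real_vector \<Rightarrow> 'a \<Rightarrow> 'a) \<Rightarrow> 'a \<Rightarrow> 'a \<Rightarrow> 'a"
  where "jordan_Q m a = (\<lambda>b. 2 *\<^sub>R jordan_T m a (jordan_T m a b) - jordan_T m (m a a) b)"

definition operator_commute :: "('a \<Rightarrow> 'a \<Rightarrow> 'a) \<Rightarrow> 'a \<Rightarrow> 'a \<Rightarrow> bool"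
  where "operator_commute m a b \<longleftrightarrow> jordan_T m a \<circ> jordan_T m b = jordan_T m b \<circ> jordan_T m a"

definition jordan_positive :: "('a \<Rightarrow> 'a \<Rightarrow> 'a) \<Rightarrow> 'a \<Rightarrow> bool"
  where "jordan_positive m a \<longleftrightarrow> (\<exists>c. a = m c c)"

text \<open>A subalgebra need not contain the unit; the unit is one of the generators below.\<close>

definition closed_jordan_subalgebra ::
    "('a::real_normed_vector \<Rightarrow> 'a \<Rightarrow> 'a) \<Rightarrow> 'a set \<Rightarrow> bool"
  where "closed_jordan_subalgebra m S \<longleftrightarrow>
    closed S \<and> subspace S \<and> (\<forall>x\<in>S. \<forall>y\<in>S. m x y \<in> S)"

definition generated_jb_algebra ::
    "('a::real_normed_vector \<Rightarrow> 'a \<Rightarrow> 'a) \<Rightarrow> 'a \<Rightarrow> 'a \<Rightarrow> 'a \<Rightarrow> 'a set"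
  where "generated_jb_algebra m u a b = closed_jordan_subalgebra m hull {a, b, u}"

definition associative_on :: "('a \<Rightarrow> 'a \<Rightarrow> 'a) \<Rightarrow> 'a set \<Rightarrow> bool"
  where "associative_on m S \<longleftrightarrow> (\<forall>x\<in>S. \<forall>y\<in>S. \<forall>z\<in>S. m (m x y) z = m x (m y z))"

end

theory Submission
  imports Defs
begin

text \<open>
  Write \<open>T\<^sub>x\<close> for multiplication by \<open>x\<close>. An inner derivation \<open>D = [T\<^sub>u, T\<^sub>v]\<close> generates a one-parameter group of
  automorphisms, and automorphisms of a JB-algebra are contractive. Hence \<open>D (D x) = 0\<close> forces \<open>D x = 0\<close>, as
  \<open>exp (t D) x = x + t D x\<close> is bounded in \<open>t\<close>; in particular nilpotent inner derivations vanish. If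
  \<open>K = [T\<^sub>a, T\<^sub>b]\<close> annihilates \<open>a\<close> and \<open>b\<close>, the linearized Jordan identity makes \<open>K\<close> and then \<open>[T\<^sub>b, T\<^bsub>a*a\<^esub>]\<close>
  nilpotent, so both are 0. Consequently the commutant of an element is a closed subalgebra, which gives the
  equivalence of the first four conditions.

  The condition \<open>Q\<^sub>a b\<^sup>2 = Q\<^sub>b a\<^sup>2\<close> means that \<open>K\<close> annihilates \<open>h = a * b\<close>. If \<open>a = e\<^sup>2\<close>, then
  \<open>(T\<^sub>h + K) Q\<^sub>e = Q\<^sub>e T\<^sub>g\<close> for \<open>g = Q\<^sub>e b\<close>, whence \<open>exp (z K) Q\<^sub>e = exp (- z T\<^sub>h) Q\<^sub>e exp (z T\<^sub>g)\<close>. For imaginary \<open>z\<close> the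
  right-hand side is bounded, and for real \<open>z\<close> the operator \<open>exp (z K)\<close> is a contraction, so the left-hand side is a
  bounded entire function and \<open>K Q\<^sub>e = 0\<close>. In particular \<open>K a = 0\<close>; with \<open>K (a * b) = 0\<close> this gives
  \<open>K (K b) = 0\<close>, hence \<open>K b = 0\<close> and \<open>K = 0\<close>.
\<close>

subsection \<open>Operators on the complexification\<close>

text \<open>The summand \<open>real\<close> makes the space nontrivial even for the zero algebra, so that \<open>norm 1 = 1\<close>.\<close>

typedef (overloaded) 'a cop = "UNIV :: (('a::banach \<times> 'a \<times> real) \<Rightarrow>\<^sub>L ('a \<times> 'a \<times> real)) set"
  morphisms rep_cop Cop ..

setup_lifting type_definition_cop

text \<open>A type of its own lets composition be the ring multiplication and the identity operator
  be \<open>1\<close>, so that powers and \<open>exp\<close> apply to operators.\<close>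

instantiation cop :: (banach) real_normed_algebra_1
begin

lift_definition norm_cop :: "'a cop \<Rightarrow> real" is norm .
lift_definition zero_cop :: "'a cop" is 0 .
lift_definition one_cop :: "'a cop" is id_blinfun .
lift_definition plus_cop :: "'a cop \<Rightarrow> 'a cop \<Rightarrow> 'a cop" is "(+)" .
lift_definition minus_cop :: "'a cop \<Rightarrow> 'a cop \<Rightarrow> 'a cop" is "(-)" .
lift_definition uminus_cop :: "'a cop \<Rightarrow> 'a cop" is uminus .
lift_definition times_cop :: "'a cop \<Rightarrow> 'a cop \<Rightarrow> 'a cop" is "(o\<^sub>L)" .
lift_definition scaleR_cop :: "real \<Rightarrow> 'a cop \<Rightarrow> 'a cop" is scaleR .

definition "dist_cop (A :: 'a cop) B = norm (A - B)"
definition "sgn_cop (A :: 'a cop) = scaleR (inverse (norm A)) A"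
definition "uniformity_cop = (INF e\<in>{0 <..}. principal {(A :: 'a cop, B). dist A B < e})"
definition "open_cop (S :: 'a cop set) = (\<forall>A\<in>S. \<forall>\<^sub>F (A', B) in uniformity. A' = A \<longrightarrow> B \<in> S)"

instance
proof
  have "id_blinfun (0, 0, 1) \<noteq> (0 :: ('a \<times> 'a \<times> real) \<Rightarrow>\<^sub>L ('a \<times> 'a \<times> real)) (0, 0, 1)"
    by (simp add: zero_prod_def)
  then have "(id_blinfun :: ('a \<times> 'a \<times> real) \<Rightarrow>\<^sub>L _) \<noteq> 0"
    by metis
  then show "(0 :: 'a cop) \<noteq> 1"
    by transfer simp
  have "norm (id_blinfun :: ('a \<times> 'a \<times> real) \<Rightarrow>\<^sub>L _) \<ge> 1"
    using norm_blinfun[of "id_blinfun :: ('a \<times> 'a \<times> real) \<Rightarrow>\<^sub>L _" "(0, 0, 1)"]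
    by (simp add: norm_Pair)
  moreover have "norm (id_blinfun :: ('a \<times> 'a \<times> real) \<Rightarrow>\<^sub>L _) \<le> 1"
    by (rule norm_blinfun_id_le)
  ultimately show "norm (1 :: 'a cop) = 1"
    by transfer simp
  fix A B C :: "'a cop" and r s :: real
  show "A + B + C = A + (B + C)" "A + B = B + A" "0 + A = A" "- A + A = 0" "A - B = A + - B"
    "r *\<^sub>R (A + B) = r *\<^sub>R A + r *\<^sub>R B" "(r + s) *\<^sub>R A = r *\<^sub>R A + s *\<^sub>R A"
    "r *\<^sub>R s *\<^sub>R A = (r * s) *\<^sub>R A" "1 *\<^sub>R A = A"
    by (transfer; simp add: scaleR_add_left scaleR_add_right)+
  show "A * B * C = A * (B * C)" "1 * A = A" "A * 1 = A"
    by (transfer; auto intro!: blinfun_eqI)+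
  show "(A + B) * C = A * C + B * C" "A * (B + C) = A * B + A * C"
    "r *\<^sub>R A * B = r *\<^sub>R (A * B)" "A * r *\<^sub>R B = r *\<^sub>R (A * B)"
    by (transfer; auto intro!: blinfun_eqI simp: blinfun.bilinear_simps)+
  show "dist A B = norm (A - B)" "sgn A = scaleR (inverse (norm A)) A"
    by (simp_all add: dist_cop_def sgn_cop_def)
  show "(norm A = 0) = (A = 0)" "norm (A + B) \<le> norm A + norm B" "norm (r *\<^sub>R A) = \<bar>r\<bar> * norm A"
    by (transfer; simp add: norm_triangle_ineq)+
  show "norm (A * B) \<le> norm A * norm B"
    by transfer (rule norm_blinfun_compose)
  show "uniformity = (INF e\<in>{0 <..}. principal {(A :: 'a cop, B). dist A B < e})"
    by (rule uniformity_cop_def)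
  fix S :: "'a cop set"
  show "open S = (\<forall>A\<in>S. \<forall>\<^sub>F (A', B) in uniformity. A' = A \<longrightarrow> B \<in> S)"
    by (rule open_cop_def)
qed

end

lemma dist_rep_cop: "dist (rep_cop A) (rep_cop B) = dist A B"
  by (simp add: dist_norm norm_cop.rep_eq minus_cop.rep_eq)

instance cop :: (banach) banach
proof
  fix X :: "nat \<Rightarrow> 'a cop"
  assume "Cauchy X"
  then have "Cauchy (\<lambda>n. rep_cop (X n))"
    by (simp add: Cauchy_def dist_rep_cop)
  then obtain L where "(\<lambda>n. rep_cop (X n)) \<longlonglongrightarrow> L"
    using Cauchy_convergent convergent_def by blast
  then have "X \<longlonglongrightarrow> Cop L"
    by (simp add: lim_sequentially Cop_inverse flip: dist_rep_cop)
  then show "convergent X"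
    by (auto simp: convergent_def)
qed

section \<open>Action of operators on vectors, and the imaginary unit\<close>

definition capp :: "'a::banach cop \<Rightarrow> 'a \<times> 'a \<times> real \<Rightarrow> 'a \<times> 'a \<times> real"
  where "capp A = blinfun_apply (rep_cop A)"

lemma bounded_bilinear_capp: "bounded_bilinear (capp :: 'a::banach cop \<Rightarrow> _)"
proof
  fix A B :: "'a cop" and v w and r :: real
  show "capp (A + B) v = capp A v + capp B v" "capp A (v + w) = capp A v + capp A w"
    "capp (r *\<^sub>R A) v = r *\<^sub>R capp A v" "capp A (r *\<^sub>R v) = r *\<^sub>R capp A v"
    by (simp_all add: capp_def plus_cop.rep_eq scaleR_cop.rep_eq blinfun.bilinear_simps)
  show "\<exists>K. \<forall>(A :: 'a cop) v. norm (capp A v) \<le> norm A * norm v * K"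
    by (intro exI[of _ 1]) (simp add: capp_def norm_cop.rep_eq norm_blinfun)
qed

interpretation capp: bounded_bilinear "capp :: 'a::banach cop \<Rightarrow> _"
  by (rule bounded_bilinear_capp)

lemma capp_mult [simp]: "capp (A * B) v = capp A (capp B v)"
  by (simp add: capp_def times_cop.rep_eq)

lemma capp_one [simp]: "capp 1 v = v"
  by (simp add: capp_def one_cop.rep_eq)

lemma norm_capp: "norm (capp A v) \<le> norm A * norm v"
  by (simp add: capp_def norm_cop.rep_eq norm_blinfun)

lemma norm_cop_bound: "norm A \<le> c" if "0 \<le> c" "\<And>v. norm (capp A v) \<le> c * norm v"
  using that by (simp add: capp_def norm_cop.rep_eq norm_blinfun_bound)

lemma cop_eqI: "A = B" if "\<And>v. capp A v = capp B v"
  using that by (metis capp_def blinfun_eqI rep_cop_inject)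

lemma capp_Cop: "capp (Cop (Blinfun f)) = f" if "bounded_linear f"
  using that by (simp add: capp_def Cop_inverse bounded_linear_Blinfun_apply)

text \<open>Multiplication by the imaginary unit, with \<open>(x, y)\<close> read as x + iy. It is 0
  on the real summand, so its square acts as -1 only on operators whose range lies in the
  complexification.\<close>

definition imag_cop :: "'a::banach cop"
  where "imag_cop = Cop (Blinfun (\<lambda>v. (- fst (snd v), fst v, 0)))"

lemma capp_imag [simp]: "capp imag_cop (x, y, r) = (- y, x, 0)"
proof -
  have "bounded_linear (\<lambda>v :: 'a \<times> 'a \<times> real. (- fst (snd v), fst v, 0 :: real))"
    by (intro bounded_linear_Pair bounded_linear_minus bounded_linear_fst_comp bounded_linear_snd_comp
      bounded_linear_ident bounded_linear_zero)
  then show ?thesis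
    by (simp add: imag_cop_def capp_Cop)
qed

lemma norm_imag_le: "norm (imag_cop :: 'a::banach cop) \<le> 1"
proof (rule norm_cop_bound)
  fix v :: "'a \<times> 'a \<times> real"
  obtain x y r where v: "v = (x, y, r)"
    by (metis prod_cases3)
  show "norm (capp imag_cop v) \<le> 1 * norm v"
    by (simp add: v norm_Pair)
qed simp


subsection \<open>Exponentials\<close>

lemma exp_intertwine:
  fixes A B Z :: "'a::{real_normed_algebra_1,banach}"
  assumes "A * Z = Z * B"
  shows "exp A * Z = Z * exp B"
proof -
  have pow: "A ^ n * Z = Z * B ^ n" for n
  proof (induction n)
    case (Suc n)
    have "A ^ Suc n * Z = A * (A ^ n * Z)"
      by (simp add: mult.assoc)
    also have "\<dots> = Z * B ^ Suc n"
      by (simp add: Suc assms flip: mult.assoc)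
    finally show ?case .
  qed simp
  have "exp A * Z = (\<Sum>n. (A ^ n /\<^sub>R fact n) * Z)"
    unfolding exp_def by (rule suminf_mult2[OF summable_exp_generic])
  also have "\<dots> = (\<Sum>n. Z * (B ^ n /\<^sub>R fact n))"
    by (simp add: pow)
  also have "\<dots> = Z * exp B"
    unfolding exp_def by (rule suminf_mult[OF summable_exp_generic])
  finally show ?thesis .
qed

lemma exp_scaleR_has_vector_derivative:
  fixes A :: "'a::{real_normed_algebra_1,banach}"
  shows "((\<lambda>t. exp (t *\<^sub>R A)) has_vector_derivative A * exp (t *\<^sub>R A)) (at t within S)"
  using exp_scaleR_has_vector_derivative_right[of A t S]
  by (metis exp_intertwine mult_scaleR_left mult_scaleR_right)

lemma vector_derivative_zero_constant:
  fixes f :: "real \<Rightarrow> 'a::real_normed_vector"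
  assumes "\<And>t. (f has_vector_derivative 0) (at t)"
  shows "f t = f 0"
proof -
  obtain c where "f x = c" for x
    using has_vector_derivative_zero_constant[of UNIV f] assms by auto
  then show ?thesis by simp
qed

text \<open>The curve exp(-tA)(v + tAv) has derivative 0, since the product rule leaves only a
  multiple of A(Av). It therefore keeps its initial value v.\<close>

lemma capp_exp_nilpotent:
  fixes A :: "'a::banach cop"
  assumes "capp A (capp A v) = 0"
  shows "capp (exp (t *\<^sub>R A)) v = v + t *\<^sub>R capp A v"
proof -
  let ?f = "\<lambda>t. capp (exp (t *\<^sub>R - A)) (v + t *\<^sub>R capp A v)"
  have "(?f has_vector_derivative 0) (at t)" for t
  proof -
    have "(?f has_vector_derivative capp (exp (t *\<^sub>R - A)) (capp A v)
        + capp (exp (t *\<^sub>R - A) * - A) (v + t *\<^sub>R capp A v)) (at t)"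
      by (rule capp.has_vector_derivative[OF exp_scaleR_has_vector_derivative_right])
        (auto intro!: derivative_eq_intros)
    then show ?thesis
      by (simp add: capp.add_right capp.scaleR_right assms capp.minus_left capp.minus_right capp.zero_right)
  qed
  from vector_derivative_zero_constant[of ?f, OF this]
  have "capp (exp (- (t *\<^sub>R A))) (v + t *\<^sub>R capp A v) = v"
    by simp
  then have "capp (exp (t *\<^sub>R A) * exp (- (t *\<^sub>R A))) (v + t *\<^sub>R capp A v) = capp (exp (t *\<^sub>R A)) v"
    by simp
  then show ?thesis
    by (simp only: exp_minus_inverse capp_one)
qed

lemma linear_bounded_imp_zero:
  fixes v w :: "'a::real_normed_vector"
  assumes "\<And>t. norm (v + t *\<^sub>R w) \<le> M"
  shows "w = 0"
proof (rule ccontr)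
  assume "w \<noteq> 0"
  define t where "t = (M + norm v + 1) / norm w"
  have "norm (t *\<^sub>R w) \<le> norm (v + t *\<^sub>R w) + norm v"
    by (metis add.commute norm_triangle_sub add_diff_cancel_left' norm_triangle_ineq4)
  also have "\<dots> \<le> M + norm v"
    using assms by simp
  finally have "\<bar>t\<bar> * norm w \<le> M + norm v" by simp
  moreover have "\<bar>t\<bar> * norm w \<ge> M + norm v + 1"
  proof -
    have "t * norm w = M + norm v + 1"
      using \<open>w \<noteq> 0\<close> by (simp add: t_def)
    moreover have "t * norm w \<le> \<bar>t\<bar> * norm w"
      by (intro mult_right_mono) auto
    ultimately show ?thesis by simp
  qed
  ultimately show False by simp
qed

lemma capp_nilpotent_imp_zero:
  fixes A :: "'a::banach cop"
  assumes "capp A (capp A v) = 0" "\<And>t. norm (capp (exp (t *\<^sub>R A)) v) \<le> M"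
  shows "capp A v = 0"
  using assms linear_bounded_imp_zero[of v "capp A v" M] by (simp add: capp_exp_nilpotent)


subsection \<open>Operator identities\<close>

text \<open>Unfolding numeric coefficients into repeated sums lets ring normalization cancel
  noncommutative monomials one by one.\<close>

lemma scaleR_numerals:
  fixes x :: "'b::real_vector"
  shows "2 *\<^sub>R x = x + x" "3 *\<^sub>R x = x + x + x" "4 *\<^sub>R x = x + x + x + x"
  using scaleR_left_distrib[of 2 1 x] scaleR_left_distrib[of 2 2 x] by (simp_all add: scaleR_2)

definition comm :: "'b::ring \<Rightarrow> 'b \<Rightarrow> 'b"
  where "comm x y = x * y - y * x"

lemma comm_simps:
  "comm (x + y) z = comm x z + comm y z" "comm x (y + z) = comm x y + comm x z"
  "comm (x - y) z = comm x z - comm y z" "comm x (y - z) = comm x y - comm x z"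
  "comm (- x) z = - comm x z" "comm x (- y) = - comm x y" "comm x 0 = 0" "comm 0 x = 0"
  "comm (x * y) z = x * comm y z + comm x z * y" "comm x (y * z) = comm x y * z + y * comm x z"
  by (simp_all add: comm_def algebra_simps)

lemma comm_scaleR:
  fixes x y :: "'b::real_algebra"
  shows "comm (r *\<^sub>R x) y = r *\<^sub>R comm x y" "comm x (r *\<^sub>R y) = r *\<^sub>R comm x y"
  by (simp_all add: comm_def algebra_simps)

lemma comm_self [simp]: "comm x x = 0"
  by (simp add: comm_def)

lemma comm_swap: "comm y x = - comm x y"
  by (simp add: comm_def)

lemma comm_eq_0_iff: "comm x y = 0 \<longleftrightarrow> x * y = y * x"
  by (simp add: comm_def)

lemma comm_comm: "comm x (comm y z) = comm (comm x y) z + comm y (comm x z)"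
  by (simp add: comm_def algebra_simps)

section \<open>Linearizations of the Jordan identity\<close>

context jordan_algebra
begin

lemmas jmult_simps =
  bilinear_ladd[OF bilinear_jmult] bilinear_radd[OF bilinear_jmult]
  bilinear_lsub[OF bilinear_jmult] bilinear_rsub[OF bilinear_jmult]
  bilinear_lneg[OF bilinear_jmult] bilinear_rneg[OF bilinear_jmult]
  bilinear_lmul[OF bilinear_jmult] bilinear_rmul[OF bilinear_jmult]
  bilinear_lzero[OF bilinear_jmult] bilinear_rzero[OF bilinear_jmult]

lemma unit_right: "a \<star> unit = a"
  by (metis jmult_commute unit_left)

lemma jordan_identity': "a \<star> ((a \<star> a) \<star> x) = (a \<star> a) \<star> (a \<star> x)"
  by (metis jordan_identity jmult_commute)

text \<open>Polarization: the defect \<open>J\<close> is cubic in its argument, so the alternating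
  sum of its values at the subsums of a, b, c isolates the trilinear part, with every term counted
  twice.\<close>

lemma jordan_identity_linearized:
  "a \<star> ((b \<star> c) \<star> x) + b \<star> ((c \<star> a) \<star> x) + c \<star> ((a \<star> b) \<star> x)
    = (b \<star> c) \<star> (a \<star> x) + (c \<star> a) \<star> (b \<star> x) + (a \<star> b) \<star> (c \<star> x)"
proof -
  define J where "J u = u \<star> ((u \<star> u) \<star> x) - (u \<star> u) \<star> (u \<star> x)" for u
  have J: "J u = 0" for u
    by (simp add: J_def jordan_identity')
  have "2 *\<^sub>R (a \<star> ((b \<star> c) \<star> x) + b \<star> ((c \<star> a) \<star> x) + c \<star> ((a \<star> b) \<star> x))
      - 2 *\<^sub>R ((b \<star> c) \<star> (a \<star> x) + (c \<star> a) \<star> (b \<star> x) + (a \<star> b) \<star> (c \<star> x))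
    = J (a + b + c) - J (a + b) - J (b + c) - J (a + c) + J a + J b + J c"
    unfolding J_def
    by (simp add: jmult_simps algebra_simps jmult_commute[of b a] jmult_commute[of c a]
        jmult_commute[of c b] scaleR_2)
  then show ?thesis
    by (simp add: J flip: scaleR_diff_right)
qed

definition inner_der :: "'a \<Rightarrow> 'a \<Rightarrow> 'a \<Rightarrow> 'a"
  where "inner_der a b x = a \<star> (b \<star> x) - b \<star> (a \<star> x)"

text \<open>The right-hand side of the linearized identity is symmetric under exchange of c and x,
  so the left-hand sides before and after the exchange agree. This expresses multiplication by a
  triple product through shorter factors.\<close>

lemma jmult_triple:
  "a \<star> ((b \<star> c) \<star> x) + b \<star> ((c \<star> a) \<star> x) + c \<star> ((a \<star> b) \<star> x)
    = a \<star> (c \<star> (b \<star> x)) + b \<star> (c \<star> (a \<star> x)) + ((a \<star> b) \<star> c) \<star> x"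
  using jordan_identity_linearized[of a b c x] jordan_identity_linearized[of a b x c]
  unfolding jmult_commute[of "b \<star> x" c] jmult_commute[of x a] jmult_commute[of "a \<star> x" c]
    jmult_commute[of x "(a \<star> b) \<star> c"] jmult_commute[of "b \<star> x" "a \<star> c"] jmult_commute[of c a]
    jmult_commute[of "a \<star> x" "b \<star> c"] jmult_commute[of x c]
  by (metis add.commute)

end

section \<open>Multiplication operators and their commutators on the complexification\<close>

context jb_algebra
begin

lemma norm_unit_le: "norm unit \<le> 1"
proof -
  have "(norm unit)\<^sup>2 = norm unit"
    by (simp add: unit_left flip: norm_square)
  then show ?thesis
    by (auto simp: power2_eq_square)
qed

sublocale jmult: bounded_bilinear "(\<star>)"
  by unfold_locales
    (use norm_jmult_le in \<open>auto simp: jmult_simps intro!: exI[of _ 1]\<close>)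

text \<open>The complexified multiplication operator, extended by 0 to the real summand.
  Consequently \<open>mop unit\<close> is not \<open>1\<close> but the projection onto the
  complexification.\<close>

definition mop :: "'a \<Rightarrow> 'a cop"
  where "mop a = Cop (Blinfun (\<lambda>v. (a \<star> fst v, a \<star> fst (snd v), 0)))"

lemma capp_mop_eq: "capp (mop a) v = (a \<star> fst v, a \<star> fst (snd v), 0)"
proof -
  have "bounded_linear (\<lambda>v :: 'a \<times> 'a \<times> real. (a \<star> fst v, a \<star> fst (snd v), 0 :: real))"
    by (intro bounded_linear_Pair bounded_linear_fst_comp bounded_linear_snd_comp
      bounded_linear_ident bounded_linear_zero jmult.bounded_linear_right[THEN bounded_linear_compose])
  then show ?thesis
    by (simp add: mop_def capp_Cop)
qed

lemma capp_mop [simp]: "capp (mop a) (x, y, r) = (a \<star> x, a \<star> y, 0)"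
  by (simp add: capp_mop_eq)

lemma norm_mop_le: "norm (mop a) \<le> norm a"
proof (rule norm_cop_bound)
  fix v :: "'a \<times> 'a \<times> real"
  obtain x y r where v: "v = (x, y, r)"
    by (metis prod_cases3)
  have "(norm (a \<star> x))\<^sup>2 + (norm (a \<star> y))\<^sup>2 \<le> (norm a * norm x)\<^sup>2 + (norm a * norm y)\<^sup>2"
    by (intro add_mono power_mono norm_jmult_le norm_ge_zero)
  also have "\<dots> \<le> (norm a)\<^sup>2 * ((norm x)\<^sup>2 + ((norm y)\<^sup>2 + r\<^sup>2))"
    by (simp add: algebra_simps power_mult_distrib)
  finally have "sqrt ((norm (a \<star> x))\<^sup>2 + (norm (a \<star> y))\<^sup>2)
      \<le> sqrt ((norm a)\<^sup>2 * ((norm x)\<^sup>2 + ((norm y)\<^sup>2 + r\<^sup>2)))"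
    by (rule real_sqrt_le_mono)
  then show "norm (capp (mop a) v) \<le> norm a * norm v"
    by (simp add: v norm_Pair real_sqrt_mult)
qed simp

lemma mop_add: "mop (x + y) = mop x + mop y"
  by (rule cop_eqI) (simp add: capp_mop_eq capp.add_left jmult_simps)

lemma mop_diff: "mop (x - y) = mop x - mop y"
  by (rule cop_eqI) (simp add: capp_mop_eq capp.diff_left jmult_simps)

lemma mop_scaleR: "mop (r *\<^sub>R x) = r *\<^sub>R mop x"
  by (rule cop_eqI) (simp add: capp_mop_eq capp.scaleR_left jmult_simps)

lemma mop_minus: "mop (- x) = - mop x"
  by (rule cop_eqI) (simp add: capp_mop_eq capp.minus_left jmult_simps)

lemma mop_zero [simp]: "mop 0 = 0"
  using mop_minus[of 0] by (metis mop_diff diff_self)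

lemma bounded_linear_mop: "bounded_linear mop"
  by (rule bounded_linear_intro[where K = 1])
    (simp_all add: mop_add mop_scaleR norm_mop_le)

lemma mop_linearized:
  "comm (mop a) (mop (b \<star> c)) + comm (mop b) (mop (c \<star> a)) + comm (mop c) (mop (a \<star> b)) = 0"
proof (rule cop_eqI)
  fix v :: "'a \<times> 'a \<times> real"
  show "capp (comm (mop a) (mop (b \<star> c)) + comm (mop b) (mop (c \<star> a)) + comm (mop c) (mop (a \<star> b))) v
      = capp 0 v"
    using jordan_identity_linearized[of a b c "fst v"]
      jordan_identity_linearized[of a b c "fst (snd v)"]
    by (simp add: comm_def capp_mop_eq capp.add_left capp.diff_left capp.zero_left zero_prod_def
      algebra_simps)
qed

lemma mop_triple:
  "mop ((a \<star> b) \<star> c) = mop a * mop (b \<star> c) + mop b * mop (a \<star> c) + mop c * mop (a \<star> b)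
    - mop a * mop c * mop b - mop b * mop c * mop a"
proof (rule cop_eqI)
  fix v :: "'a \<times> 'a \<times> real"
  show "capp (mop ((a \<star> b) \<star> c)) v = capp (mop a * mop (b \<star> c) + mop b * mop (a \<star> c)
      + mop c * mop (a \<star> b) - mop a * mop c * mop b - mop b * mop c * mop a) v"
    using jmult_triple[of a b c "fst v"] jmult_triple[of a b c "fst (snd v)"]
    by (simp add: capp_mop_eq capp.add_left capp.diff_left jmult_commute[of c a] algebra_simps)
qed

lemma mop_square_commute: "mop a * mop (a \<star> a) = mop (a \<star> a) * mop a"
  by (rule cop_eqI) (simp add: capp_mop_eq jordan_identity')

definition dop :: "'a \<Rightarrow> 'a \<Rightarrow> 'a cop"
  where "dop a b = comm (mop a) (mop b)"

lemma capp_dop [simp]: "capp (dop a b) (x, y, r) = (inner_der a b x, inner_der a b y, 0)"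
  by (simp add: dop_def comm_def capp.diff_left inner_der_def)

lemma dop_swap: "dop b a = - dop a b"
  unfolding dop_def by (rule comm_swap)

lemma inner_der_swap: "inner_der b a x = - inner_der a b x"
  by (simp add: inner_der_def)

lemma dop_linearized: "dop a (b \<star> c) + dop b (c \<star> a) + dop c (a \<star> b) = 0"
  using mop_linearized by (simp add: dop_def)

lemma dop_square: "dop b (a \<star> a) = - 2 *\<^sub>R dop a (a \<star> b)"
  using dop_linearized[of a a b] by (simp add: jmult_commute[of b a] scaleR_2 algebra_simps eq_neg_iff_add_eq_0)

text \<open>Operator form of the derivation property. Subtracting the triple formulas for (b * c) *
  a and (a * c) * b cancels all terms that contain a multiplication by a product.\<close>

lemma mop_inner_der: "mop (inner_der a b c) = comm (dop a b) (mop c)"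
proof -
  have "inner_der a b c = (b \<star> c) \<star> a - (a \<star> c) \<star> b"
    by (simp add: inner_der_def jmult_commute)
  then have "mop (inner_der a b c) = mop ((b \<star> c) \<star> a) - mop ((a \<star> c) \<star> b)"
    by (simp add: mop_diff)
  then show ?thesis
    by (simp add: mop_triple[of b c a] mop_triple[of a c b] dop_def
      jmult_commute[of b a] jmult_commute[of c a] jmult_commute[of c b] comm_def algebra_simps)
qed

lemma inner_der_mult: "inner_der a b (x \<star> y) = inner_der a b x \<star> y + x \<star> inner_der a b y"
proof -
  have "capp (mop (inner_der a b x)) (y, 0, 0) = capp (comm (dop a b) (mop x)) (y, 0, 0)"
    by (simp add: mop_inner_der)
  then show ?thesis
    by (simp add: comm_def capp.diff_left jmult_simps inner_der_def)
qed

lemma inner_der_simps: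
  "inner_der a b (x + y) = inner_der a b x + inner_der a b y"
  "inner_der a b (x - y) = inner_der a b x - inner_der a b y"
  "inner_der a b (r *\<^sub>R x) = r *\<^sub>R inner_der a b x"
  "inner_der a b (- x) = - inner_der a b x"
  "inner_der a b 0 = 0"
  by (simp_all add: inner_der_def jmult_simps algebra_simps)

lemma inner_der_eq: "inner_der a b x = fst (capp (dop a b) (x, 0, 0))"
  by simp

lemma dop_eq_0_iff: "dop a b = 0 \<longleftrightarrow> (\<forall>x. inner_der a b x = 0)"
proof
  assume "dop a b = 0"
  then show "\<forall>x. inner_der a b x = 0"
    by (simp add: inner_der_eq capp.zero_left)
next
  assume "\<forall>x. inner_der a b x = 0"
  then show "dop a b = 0"
    by (intro cop_eqI) (metis capp.zero_left capp_dop prod_cases3 zero_prod_def)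
qed

lemma inner_der_square: "inner_der b (a \<star> a) x = - 2 *\<^sub>R inner_der a (a \<star> b) x"
  by (simp add: inner_der_eq dop_square capp.scaleR_left capp.minus_left del: capp_dop)

lemma comm_mop_eq_0_iff: "comm (mop a) (mop b) = 0 \<longleftrightarrow> (\<forall>x. a \<star> (b \<star> x) = b \<star> (a \<star> x))"
  using dop_eq_0_iff[of a b] by (simp add: dop_def inner_der_def)

lemma dop_eq_0_iff_operator_commute: "dop a b = 0 \<longleftrightarrow> operator_commute (\<star>) a b"
  by (auto simp: dop_eq_0_iff inner_der_def operator_commute_def jordan_T_def fun_eq_iff)

end


subsection \<open>Inner derivations of JB-algebras\<close>

context jb_algebra
begin

section \<open>The one-parameter automorphism group of an inner derivation\<close>

lemma inner_der_unit: "inner_der a b unit = 0"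
  by (simp add: inner_der_def unit_right jmult_commute[of b a])

lemma fst_capp_dop: "fst (capp (dop a b) v) = inner_der a b (fst v)"
  by (cases v rule: prod_cases3) simp

definition der_flow :: "'a \<Rightarrow> 'a \<Rightarrow> real \<Rightarrow> 'a \<Rightarrow> 'a"
  where "der_flow a b t x = fst (capp (exp (t *\<^sub>R dop a b)) (x, 0, 0))"

text \<open>Conjugation by the exponential moves T_x to the multiplication by the transported x: by
  \<open>mop_inner_der\<close>, the conjugate of the latter by the inverse flow has derivative
  0.\<close>

lemma der_flow_mop:
  "mop (der_flow a b t x) * exp (t *\<^sub>R dop a b) = exp (t *\<^sub>R dop a b) * mop x"
proof -
  let ?K = "dop a b"
  let ?G = "\<lambda>t. exp (t *\<^sub>R - ?K) * (mop (der_flow a b t x) * exp (t *\<^sub>R ?K))"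
  have "(?G has_vector_derivative 0) (at t)" for t
  proof -
    have "((\<lambda>t. capp (exp (t *\<^sub>R ?K)) (x, 0, 0)) has_vector_derivative
        capp (?K * exp (t *\<^sub>R ?K)) (x, 0, 0)) (at t)"
      by (rule bounded_linear.has_vector_derivative[OF capp.bounded_linear_left exp_scaleR_has_vector_derivative])
    then have "((\<lambda>t. der_flow a b t x) has_vector_derivative
        fst (capp (?K * exp (t *\<^sub>R ?K)) (x, 0, 0))) (at t)"
      unfolding der_flow_def by (rule bounded_linear.has_vector_derivative[OF bounded_linear_fst])
    also have "fst (capp (?K * exp (t *\<^sub>R ?K)) (x, 0, 0)) = inner_der a b (der_flow a b t x)"
      by (simp add: fst_capp_dop der_flow_def)
    finally have "((\<lambda>t. mop (der_flow a b t x)) has_vector_derivative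
        comm ?K (mop (der_flow a b t x))) (at t)"
      using bounded_linear.has_vector_derivative[OF bounded_linear_mop] mop_inner_der by metis
    from has_vector_derivative_mult[OF exp_scaleR_has_vector_derivative_right
        has_vector_derivative_mult[OF this exp_scaleR_has_vector_derivative]]
    show ?thesis
      by (rule has_vector_derivative_eq_rhs) (simp add: comm_def algebra_simps)
  qed
  from vector_derivative_zero_constant[of ?G, OF this, of t]
  have "exp (- (t *\<^sub>R ?K)) * (mop (der_flow a b t x) * exp (t *\<^sub>R ?K)) = mop x"
    by (simp add: der_flow_def)
  then have "(exp (t *\<^sub>R ?K) * exp (- (t *\<^sub>R ?K))) * (mop (der_flow a b t x) * exp (t *\<^sub>R ?K))
      = exp (t *\<^sub>R ?K) * mop x"
    by (simp add: mult.assoc)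
  then show ?thesis
    by (simp add: exp_minus_inverse)
qed

text \<open>A derivation kills the unit, so its exponential fixes the unit; applying
  \<open>der_flow_mop\<close> to the unit in either coordinate identifies the exponential there with
  the same flow.\<close>

lemma capp_exp_dop: "capp (exp (t *\<^sub>R dop a b)) (x, y, 0) = (der_flow a b t x, der_flow a b t y, 0)"
proof -
  let ?e = "exp (t *\<^sub>R dop a b)"
  have unit: "capp ?e (unit, 0, 0) = (unit, 0, 0)" "capp ?e (0, unit, 0) = (0, unit, 0)"
    by (subst capp_exp_nilpotent; simp add: inner_der_unit inner_der_simps zero_prod_def)+
  have "capp ?e (x, 0, 0) = capp (?e * mop x) (unit, 0, 0)" "capp ?e (0, y, 0) = capp (?e * mop y) (0, unit, 0)"
    by (simp_all add: unit_right jmult_simps)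
  then have "capp ?e (x, 0, 0) = (der_flow a b t x, 0, 0)" "capp ?e (0, y, 0) = (0, der_flow a b t y, 0)"
    by (simp_all add: unit unit_right jmult_simps flip: der_flow_mop)
  then show ?thesis
    using capp.add_right[of ?e "(x, 0, 0)" "(0, y, 0)"] by simp
qed

lemma der_flow_mult: "der_flow a b t (x \<star> y) = der_flow a b t x \<star> der_flow a b t y"
proof -
  have "capp (mop (der_flow a b t x) * exp (t *\<^sub>R dop a b)) (y, 0, 0)
      = capp (exp (t *\<^sub>R dop a b) * mop x) (y, 0, 0)"
    by (simp only: der_flow_mop)
  then show ?thesis
    by (simp add: capp_exp_dop jmult_simps)
qed

lemma bounded_linear_der_flow: "bounded_linear (der_flow a b t)"
  unfolding der_flow_def
  by (intro bounded_linear_fst_comp bounded_linear_compose[OF capp.bounded_linear_right]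
    bounded_linear_Pair bounded_linear_ident bounded_linear_zero)

text \<open>The operator norm \<open>N\<close> of an automorphism satisfies \<open>N\<^sup>2 \<le> N\<close>, because the norm of a square is the
  square of the norm.\<close>

lemma norm_der_flow_le: "norm (der_flow a b t x) \<le> norm x"
proof -
  let ?f = "der_flow a b t"
  define N where "N = onorm ?f"
  have N: "norm (?f y) \<le> N * norm y" for y
    unfolding N_def by (rule onorm[OF bounded_linear_der_flow])
  have "0 \<le> N"
    unfolding N_def by (rule onorm_pos_le[OF bounded_linear_der_flow])
  have "norm (?f y) \<le> sqrt N * norm y" for y
  proof -
    have "(norm (?f y))\<^sup>2 \<le> N * (norm y)\<^sup>2"
      using N[of "y \<star> y"] by (simp add: der_flow_mult norm_square)
    then have "norm (?f y) \<le> sqrt (N * (norm y)\<^sup>2)"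
      by (rule real_le_rsqrt)
    then show ?thesis
      by (simp add: real_sqrt_mult)
  qed
  then have "N \<le> sqrt N"
    unfolding N_def[symmetric] using \<open>0 \<le> N\<close> by (subst N_def) (intro onorm_bound; simp)
  then have "N\<^sup>2 \<le> (sqrt N)\<^sup>2"
    using \<open>0 \<le> N\<close> by (intro power_mono)
  then have "N \<le> 1"
    using \<open>0 \<le> N\<close> by (cases "N = 0") (simp_all add: power2_eq_square)
  then show ?thesis
    using N[of x] mult_right_mono[of N 1 "norm x"] by simp
qed

lemma inner_der_nilpotent:
  assumes "inner_der a b (inner_der a b x) = 0"
  shows "inner_der a b x = 0"
proof -
  have "capp (dop a b) (x, 0, 0) = 0"
  proof (rule capp_nilpotent_imp_zero)
    show "capp (dop a b) (capp (dop a b) (x, 0, 0)) = 0"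
      using assms by (simp add: inner_der_simps zero_prod_def)
    show "norm (capp (exp (t *\<^sub>R dop a b)) (x, 0, 0)) \<le> norm x" for t
      using norm_der_flow_le[of a b t x] linear_0[OF bounded_linear.linear[OF bounded_linear_der_flow]]
      by (simp add: capp_exp_dop norm_Pair)
  qed
  then show ?thesis
    by (simp add: zero_prod_def)
qed

lemma dop_nilpotent:
  assumes "dop a b * (dop a b * dop a b) = 0"
  shows "dop a b = 0"
proof -
  have "inner_der a b x = 0" for x
  proof -
    have "capp (dop a b * (dop a b * dop a b)) (x, 0, 0) = 0"
      by (simp only: assms capp.zero_left)
    then have "inner_der a b (inner_der a b (inner_der a b x)) = 0"
      by (simp add: zero_prod_def)
    then show ?thesis
      by (rule inner_der_nilpotent[OF inner_der_nilpotent])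
  qed
  then show ?thesis
    by (simp add: dop_eq_0_iff)
qed

section \<open>Inner derivations [T_a, T_b] that annihilate a and b\<close>

lemma inner_der_mult_eq_0: "inner_der a b (x \<star> y) = 0" if "inner_der a b x = 0" "inner_der a b y = 0"
  using that by (simp add: inner_der_mult jmult_simps)

lemma comm_dop_eq_0: "comm (dop a b) (mop x) = 0" if "inner_der a b x = 0"
  using that by (simp flip: mop_inner_der)

text \<open>Both terms of the difference equal a * (b * (a * a)), one by the hypothesis and the
  other by the Jordan identity.\<close>

lemma inner_der_square_self: "inner_der b (a \<star> a) a = 0" if "inner_der a b (a \<star> a) = 0"
proof -
  have "b \<star> ((a \<star> a) \<star> a) = a \<star> (b \<star> (a \<star> a))"
    using that by (simp add: inner_der_def jmult_commute[of "a \<star> a" a])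
  moreover have "(a \<star> a) \<star> (b \<star> a) = a \<star> (b \<star> (a \<star> a))"
    using jordan_identity'[of a b] by (simp add: jmult_commute[of b])
  ultimately show ?thesis
    by (simp add: inner_der_def)
qed

text \<open>In the Leibniz expansion the mixed terms add up to minus the original value, whence the
  factor 2. The right-hand side is what \<open>jordan_Q_eq_iff\<close> compares with the quadratic
  maps.\<close>

lemma inner_der_product:
  "2 *\<^sub>R inner_der a b (a \<star> b) = a \<star> (a \<star> (b \<star> b)) - b \<star> (b \<star> (a \<star> a))"
proof -
  have "inner_der a b (a \<star> b) = (a \<star> (a \<star> b) - b \<star> (a \<star> a)) \<star> b + a \<star> (a \<star> (b \<star> b) - b \<star> (a \<star> b))"
    by (subst inner_der_mult) (simp add: inner_der_def jmult_commute[of b a])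
  also have "\<dots> = b \<star> (a \<star> (a \<star> b)) - b \<star> (b \<star> (a \<star> a)) + a \<star> (a \<star> (b \<star> b)) - a \<star> (b \<star> (a \<star> b))"
    by (simp add: jmult_simps jmult_commute[of "a \<star> (a \<star> b)" b] jmult_commute[of "b \<star> (a \<star> a)" b])
  also have "\<dots> = a \<star> (a \<star> (b \<star> b)) - b \<star> (b \<star> (a \<star> a)) - inner_der a b (a \<star> b)"
    by (simp add: inner_der_def)
  finally show ?thesis
    by (simp add: scaleR_2 algebra_simps)
qed

text \<open>With D = [T_b, T_{a*a}] and c = D b, it suffices to show D c = 0, by
  \<open>inner_der_nilpotent\<close>. This follows once T_c commutes with T_a and T_{a*b}; the
  second commutation comes from computing [D, F] in two ways, where F = [T_a, T_{b*b}].\<close>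

lemma inner_der_annihilates_generators:
  assumes "inner_der a b a = 0" "inner_der a b b = 0"
  shows "inner_der b (a \<star> a) b = 0"
proof -
  define A B X Y P where "A = mop a" and "B = mop b" and "X = mop (a \<star> a)"
    and "Y = mop (b \<star> b)" and "P = mop (a \<star> b)"
  define K D F where "K = dop a b" and "D = dop b (a \<star> a)" and "F = dop a (b \<star> b)"
  define c where "c = inner_der b (a \<star> a) b"
  have Ka: "inner_der a b (a \<star> a) = 0" "inner_der a b (a \<star> b) = 0" "inner_der a b (b \<star> b) = 0"
    using assms by (simp_all add: inner_der_mult_eq_0)
  have K: "comm K A = 0" "comm K B = 0" "comm K X = 0" "comm K Y = 0"
    using assms Ka by (simp_all add: K_def A_def B_def X_def Y_def comm_dop_eq_0)
  have K_eq: "K = comm A B" and D_eq: "D = comm B X" and F_eq: "F = comm A Y"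
    by (simp_all add: K_def D_def F_def A_def B_def X_def Y_def dop_def)
  have D_eq': "D = - 2 *\<^sub>R comm A P"
    by (simp add: D_def A_def P_def dop_square) (simp add: dop_def)
  have Da: "inner_der b (a \<star> a) a = 0" and Fb: "inner_der a (b \<star> b) b = 0"
    using inner_der_square_self[of a b] inner_der_square_self[of b a] Ka
    by (simp_all add: inner_der_swap[of b a])
  \<comment> \<open>Since K annihilates a * b, \<open>inner_der_product\<close> equates F a with D
    b.\<close>
  have Fa: "inner_der a (b \<star> b) a = c"
    using inner_der_product[of a b, unfolded Ka]
    by (simp add: c_def inner_der_def jmult_commute[of "a \<star> a" b] jmult_commute[of "b \<star> b" a]
        jmult_commute[of "b \<star> b" "a \<star> a"])
  have DA: "comm D A = 0" and DB: "comm D B = mop c" and FA: "comm F A = mop c" and FB: "comm F B = 0"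
    using Da Fb Fa by (simp_all add: D_def F_def A_def B_def c_def flip: mop_inner_der)
  have "comm K D = 0"
    using K by (simp add: D_eq comm_comm[of K] comm_simps)
  then have "comm D K = 0"
    by (simp add: comm_swap[of D K])
  have "comm K F = 0"
    using K by (simp add: F_eq comm_comm[of K] comm_simps)
  then have "comm F K = 0"
    by (simp add: comm_swap[of F K])
  \<comment> \<open>Jacobi identity for T_c = [D, B]: both [A, D] and [D, [A, B]] = [D, K]
    vanish.\<close>
  have cA: "comm A (mop c) = 0"
    unfolding DB[symmetric] using DA \<open>comm D K = 0\<close>
    by (simp add: comm_comm[of A] comm_swap[of A D] comm_simps flip: K_eq)
  have cB: "comm B (mop c) = 0"
    unfolding FA[symmetric] using FB \<open>comm F K = 0\<close>
    by (simp add: comm_comm[of B] comm_swap[of B F] comm_simps comm_swap[of B A] flip: K_eq)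
  \<comment> \<open>First computation: expand F = [A, Y] inside [D, F]. The second one expands D =
    -2 [A, P] inside [F, D]; comparison leaves only [T_c, P].\<close>
  have "comm D Y = mop (2 *\<^sub>R (b \<star> c))"
    unfolding D_def Y_def
    by (simp add: inner_der_mult jmult_commute[of c b] scaleR_2 flip: mop_inner_der c_def)
  then have "comm D F = 2 *\<^sub>R comm A (mop (b \<star> c))"
    unfolding F_eq by (simp add: comm_comm[of D] DA comm_simps mop_scaleR comm_scaleR)
  moreover have "comm F P = mop (b \<star> c)"
    unfolding F_def P_def
    by (simp add: inner_der_mult Fa Fb jmult_simps jmult_commute[of c b] flip: mop_inner_der)
  then have "comm F D = - 2 *\<^sub>R (comm (mop c) P + comm A (mop (b \<star> c)))"
    unfolding D_eq' comm_scaleR by (simp add: comm_comm[of F] FA)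
  ultimately have "comm (mop c) P = 0"
    by (simp add: comm_swap[of F D] algebra_simps)
  \<comment> \<open>Both terms of [T_a, T_{a*b}] c now equal c * (a * (a * b)), and D is -2 times
    this commutator, so D c = 0.\<close>
  then have "(a \<star> b) \<star> (c \<star> x) = c \<star> ((a \<star> b) \<star> x)" "a \<star> (c \<star> x) = c \<star> (a \<star> x)" for x
    using cA by (simp_all add: A_def P_def comm_mop_eq_0_iff)
  then have "inner_der a (a \<star> b) c = 0"
    by (simp add: inner_der_def jmult_commute[of _ c])
      (simp add: jmult_commute[of "a \<star> b" a])
  then have "inner_der b (a \<star> a) c = 0"
    by (simp add: inner_der_square)
  then show ?thesis
    using inner_der_nilpotent unfolding c_def by blast
qed

text \<open>W = [T_{a*a}, T_{a*b}] is a combination of products with a factor K or D, so it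
  annihilates b and a * b and hence commutes with T_b and T_{a*b}. The first commutation forces K^3
  = 0, the second then D^2 = 0.\<close>

lemma dop_eq_0:
  assumes "inner_der a b a = 0" "inner_der a b b = 0"
  shows "dop a b = 0" "dop b (a \<star> a) = 0"
proof -
  define A B X P where "A = mop a" and "B = mop b" and "X = mop (a \<star> a)" and "P = mop (a \<star> b)"
  define K D W where "K = dop a b" and "D = dop b (a \<star> a)" and "W = dop (a \<star> a) (a \<star> b)"
  have Ka: "inner_der a b (a \<star> a) = 0" "inner_der a b (a \<star> b) = 0"
    using assms by (simp_all add: inner_der_mult_eq_0)
  have Da: "inner_der b (a \<star> a) a = 0" "inner_der b (a \<star> a) b = 0" "inner_der b (a \<star> a) (a \<star> b) = 0"
    using inner_der_square_self[OF Ka(1)] inner_der_annihilates_generators[OF assms]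
    by (simp_all add: inner_der_mult_eq_0)
  have K: "comm K A = 0" "comm K B = 0" "comm K P = 0"
    using assms Ka by (simp_all add: K_def A_def B_def P_def comm_dop_eq_0)
  have D: "comm D A = 0" "comm D B = 0" "comm D P = 0"
    using Da by (simp_all add: D_def A_def B_def P_def comm_dop_eq_0)
  have comms: "comm A B = K" "comm B A = - K" "comm B X = D" "comm X B = - D" "comm A X = 0"
    using comm_swap[of B A] comm_swap[of X B] mop_square_commute[of a]
    by (simp_all add: A_def B_def X_def K_def D_def dop_def comm_eq_0_iff)
  have AP: "comm A P = - (1/2) *\<^sub>R D"
    by (simp add: D_def dop_square A_def P_def) (simp add: dop_def)
  have move: "A * D = D * A" "A * (D * Z) = D * (A * Z)" "A * K = K * A" "A * (K * Z) = K * (A * Z)" for Z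
    using D(1) K(1) by (simp_all add: comm_eq_0_iff flip: mult.assoc)
  \<comment> \<open>The linearized identity for a * a, a and b, with the two cubic products resolved
    by \<open>mop_triple\<close>.\<close>
  have "W = - comm A (2 *\<^sub>R (A * P) + B * X - 2 *\<^sub>R (A * B * A)) - comm B (3 *\<^sub>R (A * X) - 2 *\<^sub>R (A * A * A))"
  proof -
    have 1: "mop (b \<star> (a \<star> a)) = 2 *\<^sub>R (A * P) + B * X - 2 *\<^sub>R (A * B * A)"
      using mop_triple[of a a b]
      by (simp add: A_def B_def P_def X_def jmult_commute[of b "a \<star> a"] scaleR_2 algebra_simps)
    have 2: "mop ((a \<star> a) \<star> a) = 3 *\<^sub>R (A * X) - 2 *\<^sub>R (A * A * A)"
      using mop_triple[of a a a]
      by (simp add: A_def X_def scaleR_numerals algebra_simps)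
    have "W = - comm A (mop (b \<star> (a \<star> a))) - comm B (mop ((a \<star> a) \<star> a))"
      using dop_linearized[of "a \<star> a" a b]
      by (simp add: W_def dop_def A_def B_def algebra_simps add_eq_0_iff)
    then show ?thesis
      by (simp only: 1 2)
  qed
  also have "\<dots> = - 2 *\<^sub>R (D * A) + 2 *\<^sub>R (K * X) - 4 *\<^sub>R (K * A * A)"
    by (simp add: comm_simps comm_scaleR comms AP move algebra_simps)
      (simp add: scaleR_numerals)
  finally have W: "W = - 2 *\<^sub>R (D * A) + 2 *\<^sub>R (K * X) - 4 *\<^sub>R (K * A * A)" .
  have W_der: "inner_der (a \<star> a) (a \<star> b) x = 0"
    if "inner_der a b x = 0" "inner_der b (a \<star> a) x = 0" for x
  proof -
    have "capp W (x, 0, 0) = 0"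
      unfolding W using that assms Ka Da
      by (simp add: capp.add_left capp.diff_left capp.scaleR_left capp.minus_left K_def D_def A_def X_def
          inner_der_mult_eq_0 jmult_simps inner_der_simps zero_prod_def)
    then show ?thesis
      by (simp add: W_def zero_prod_def)
  qed
  have WB: "comm W B = 0" and WP: "comm W P = 0"
    using assms Ka Da by (simp_all add: W_def B_def P_def comm_dop_eq_0 W_der)
  have KD: "K * D = D * K"
    using comm_comm[of D A B] D by (simp add: comms comm_simps comm_eq_0_iff)
  define Z where "Z = K * D + 2 *\<^sub>R (K * K * A)"
  \<comment> \<open>[W, B] equals -4 Z. One further bracket of Z with B leaves 2 K^3.\<close>
  have "Z + Z + Z + Z = 0"
    using WB unfolding W Z_def
    by (simp add: comm_simps comm_scaleR comms K D move KD mult.assoc scaleR_numerals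
        neg_eq_iff_add_eq_0 algebra_simps)
  then have "Z = 0"
    using scaleR_numerals(3)[of Z] by simp
  then have "comm (K * D + 2 *\<^sub>R (K * K * A)) B = 0"
    by (simp add: comm_simps flip: Z_def)
  then have "K * (K * K) = 0"
    by (simp add: comm_simps comm_scaleR comms K D mult.assoc)
  then have "K = 0"
    unfolding K_def by (rule dop_nilpotent)
  then show "dop a b = 0"
    by (simp add: K_def)
  \<comment> \<open>With K = 0, W is -2 D A, and [A, P] = -D/2 turns [W, P] into D * D.\<close>
  have "D * D = 0"
    using WP unfolding W \<open>K = 0\<close> by (simp add: comm_simps comm_scaleR D AP)
  then show "dop b (a \<star> a) = 0"
    unfolding D_def by (intro dop_nilpotent) simp
qed

end


subsection \<open>Commutants and generated subalgebras\<close>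

context jb_algebra
begin

lemma dop_simps:
  "dop x (y + z) = dop x y + dop x z" "dop x (y - z) = dop x y - dop x z"
  "dop x (r *\<^sub>R y) = r *\<^sub>R dop x y" "dop x 0 = 0"
  by (simp_all add: dop_def mop_add mop_diff mop_scaleR comm_simps comm_scaleR)

lemma dop_square_right_eq_0: "dop x (y \<star> y) = 0" if "dop x y = 0"
proof -
  have "dop y x = 0"
    using that by (simp add: dop_swap[of y x])
  then show ?thesis
    by (intro dop_eq_0(2)) (simp_all add: dop_eq_0_iff)
qed

lemma closed_jordan_subalgebra_commutant: "closed_jordan_subalgebra (\<star>) {y. dop x y = 0}"
  unfolding closed_jordan_subalgebra_def
proof (intro conjI ballI)
  have "continuous_on UNIV mop"
    by (rule linear_continuous_on[OF bounded_linear_mop])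
  then show "closed {y. dop x y = 0}"
    unfolding dop_def comm_def by (intro closed_Collect_eq continuous_intros)
  show "subspace {y. dop x y = 0}"
    by (rule subspaceI) (simp_all add: dop_simps)
  fix y z
  assume yz: "y \<in> {y. dop x y = 0}" "z \<in> {y. dop x y = 0}"
  \<comment> \<open>Polarization reduces closure under products to closure under squares, which is
    \<open>dop_square_right_eq_0\<close>.\<close>
  have "(y + z) \<star> (y + z) - y \<star> y - z \<star> z = 2 *\<^sub>R (y \<star> z)"
    by (simp add: jmult_simps jmult_commute[of z y] scaleR_2)
  moreover have "dop x ((y + z) \<star> (y + z) - y \<star> y - z \<star> z) = 0"
    using yz by (simp add: dop_simps dop_square_right_eq_0 del: jmult.add_left jmult.add_right)
  ultimately show "y \<star> z \<in> {y. dop x y = 0}"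
    by (simp add: dop_simps)
qed

lemma dop_self: "dop x x = 0"
  by (simp add: dop_def)

lemma dop_unit: "dop x unit = 0"
  by (simp add: dop_eq_0_iff inner_der_def unit_left)

section \<open>The closed subalgebra generated by two elements\<close>

lemma generated_minimal:
  assumes "closed_jordan_subalgebra (\<star>) S" "a \<in> S" "b \<in> S" "unit \<in> S"
  shows "generated_jb_algebra (\<star>) unit a b \<subseteq> S"
  unfolding generated_jb_algebra_def using assms by (intro hull_minimal) auto

lemma generated_subset: "{a, b, unit} \<subseteq> generated_jb_algebra (\<star>) unit a b"
  unfolding generated_jb_algebra_def by (rule hull_subset)

lemma closed_jordan_subalgebra_generated:
  "closed_jordan_subalgebra (\<star>) (generated_jb_algebra (\<star>) unit a b)"
  unfolding generated_jb_algebra_def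
proof (rule hull_in)
  fix T
  assume "Ball T (closed_jordan_subalgebra (\<star>))"
  then show "closed_jordan_subalgebra (\<star>) (\<Inter> T)"
    unfolding closed_jordan_subalgebra_def by (auto intro!: subspace_Inter)
qed

text \<open>Minimality is used in two rounds: first the generated algebra lies in the commutants of
  a and of b; hence a and b lie in the commutant of each of its elements x, and so does the whole
  algebra.\<close>

lemma dop_generated_eq_0:
  assumes "dop a b = 0"
    and x: "x \<in> generated_jb_algebra (\<star>) unit a b" and y: "y \<in> generated_jb_algebra (\<star>) unit a b"
  shows "dop x y = 0"
proof -
  let ?G = "generated_jb_algebra (\<star>) unit a b"
  have "dop b a = 0"
    using assms by (simp add: dop_swap[of b a])
  then have "?G \<subseteq> {y. dop a y = 0}" "?G \<subseteq> {y. dop b y = 0}"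
    using assms(1)
    by (intro generated_minimal closed_jordan_subalgebra_commutant; simp add: dop_unit dop_self)+
  then have "dop x a = 0" "dop x b = 0"
    using x by (auto simp: dop_swap[of x])
  then have "?G \<subseteq> {y. dop x y = 0}"
    by (intro generated_minimal closed_jordan_subalgebra_commutant) (simp_all add: dop_unit)
  then show ?thesis
    using y by auto
qed

lemma associative_generated:
  assumes "dop a b = 0"
  shows "associative_on (\<star>) (generated_jb_algebra (\<star>) unit a b)"
  unfolding associative_on_def
proof (intro ballI)
  fix x y z
  assume "x \<in> generated_jb_algebra (\<star>) unit a b" "z \<in> generated_jb_algebra (\<star>) unit a b"
  then have "dop x z = 0"
    by (rule dop_generated_eq_0[OF assms])
  then have "inner_der x z y = 0"
    by (simp add: dop_eq_0_iff)
  then show "(x \<star> y) \<star> z = x \<star> (y \<star> z)"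
    by (simp add: inner_der_def jmult_commute[of y z] jmult_commute[of "x \<star> y" z])
qed

text \<open>Associativity of the triples b, a, a and a, b, b says that [T_a, T_b] annihilates a and
  b, which is the hypothesis of \<open>dop_eq_0\<close>.\<close>

lemma associative_generated_imp_commute:
  assumes "associative_on (\<star>) (generated_jb_algebra (\<star>) unit a b)"
  shows "dop a b = 0"
proof -
  have "(x \<star> y) \<star> z = x \<star> (y \<star> z)" if "{x, y, z} \<subseteq> {a, b, unit}" for x y z
    using assms that generated_subset[of a b] unfolding associative_on_def by blast
  then have "(b \<star> a) \<star> a = b \<star> (a \<star> a)" "(a \<star> b) \<star> b = a \<star> (b \<star> b)"
    by simp_all
  then show ?thesis
    by (intro dop_eq_0(1))
      (simp_all add: inner_der_def jmult_commute[of a "b \<star> a"] jmult_commute[of b "a \<star> b"])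
qed


subsection \<open>The exponential of an imaginary multiplication operator is bounded\<close>

lemma imag_mop: "mop x * imag_cop = imag_cop * mop x" "mop x * (imag_cop * Z) = imag_cop * (mop x * Z)"
  "imag_cop * (imag_cop * mop x) = - mop x" "imag_cop * (imag_cop * (mop x * Z)) = - (mop x * Z)"
proof -
  have 1: "mop x * imag_cop = imag_cop * mop x" and 2: "imag_cop * (imag_cop * mop x) = - mop x"
    by (rule cop_eqI, rename_tac v, case_tac v rule: prod_cases3, simp add: capp.minus_left jmult_simps)+
  show "mop x * imag_cop = imag_cop * mop x" "imag_cop * (imag_cop * mop x) = - mop x"
    by fact+
  show "mop x * (imag_cop * Z) = imag_cop * (mop x * Z)"
    by (simp add: 1 flip: mult.assoc)
  have "imag_cop * (imag_cop * (mop x * Z)) = imag_cop * (imag_cop * mop x) * Z"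
    by (simp add: mult.assoc)
  then show "imag_cop * (imag_cop * (mop x * Z)) = - (mop x * Z)"
    by (simp add: 2)
qed

lemma capp_exp_in_subspace:
  fixes A :: "'b::banach cop"
  assumes "closed S" "subspace S" "\<And>v. v \<in> S \<Longrightarrow> capp A v \<in> S" "v \<in> S"
  shows "capp (exp A) v \<in> S"
proof -
  have pow: "capp (A ^ n) v \<in> S" for n
    by (induction n) (simp_all add: assms(3,4))
  have "(\<lambda>n. A ^ n /\<^sub>R fact n) sums exp A"
    unfolding exp_def by (rule summable_sums[OF summable_exp_generic])
  then have "(\<lambda>n. capp (A ^ n /\<^sub>R fact n) v) sums capp (exp A) v"
    by (rule bounded_linear.sums[OF capp.bounded_linear_left])
  moreover have "(\<Sum>i<n. capp (A ^ i /\<^sub>R fact i) v) \<in> S" for n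
    unfolding capp.scaleR_left by (rule subspace_sum[OF assms(2)]) (rule subspace_scale[OF assms(2) pow])
  ultimately show ?thesis
    using closed_sequentially[OF assms(1), of "\<lambda>n. \<Sum>i<n. capp (A ^ i /\<^sub>R fact i) v"]
    unfolding sums_def by blast
qed

text \<open>With u = exp(itx/2) in the complexified algebra, exp(itT_x) is the quadratic operator of
  u on the complexification. Writing u = c + is, the relation c^2 + s^2 = 1 and the JB axioms bound
  c and s by 1, and the quadratic operator is a fixed polynomial in their multiplications.\<close>

lemma norm_exp_imag_mop:
  "norm (exp (t *\<^sub>R (imag_cop * mop x)) * mop unit) \<le> 12"
proof -
  define G where "G = generated_jb_algebra (\<star>) unit x x"
  define A where "A = imag_cop * mop x"
  define v where "v t = capp (exp (t *\<^sub>R A)) (unit, 0, 0)" for t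
  \<comment> \<open>These are cos(tx) and sin(tx), obtained by applying the exponential to the unit.
    They stay in the algebra generated by x, whose multiplication operators all commute.\<close>
  define c s where "c t = fst (v t)" and "s t = fst (snd (v t))" for t
  have G: "closed G" "subspace G" "\<And>y z. y \<in> G \<Longrightarrow> z \<in> G \<Longrightarrow> y \<star> z \<in> G" and x: "x \<in> G" "unit \<in> G"
    using closed_jordan_subalgebra_generated[of x x] generated_subset[of x x]
    by (auto simp: G_def closed_jordan_subalgebra_def)
  have "dop y z = 0" if "y \<in> G" "z \<in> G" for y z
    using that unfolding G_def by (rule dop_generated_eq_0[OF dop_self])
  then have commute: "mop y * mop z = mop z * mop y" if "y \<in> G" "z \<in> G" for y z
    using that by (simp add: dop_def comm_eq_0_iff)
  then have left_commute: "mop y * (mop z * Z) = mop z * (mop y * Z)" if "y \<in> G" "z \<in> G" for y z Z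
    using that by (simp flip: mult.assoc)
  have v: "v t \<in> G \<times> G \<times> UNIV" for t
    unfolding v_def
  proof (rule capp_exp_in_subspace)
    show "closed (G \<times> G \<times> (UNIV :: real set))"
      by (intro closed_Times G closed_UNIV)
    show "subspace (G \<times> G \<times> (UNIV :: real set))"
      by (intro subspace_Times G subspace_UNIV)
    show "(unit, 0, 0) \<in> G \<times> G \<times> UNIV"
      using x(2) subspace_0[OF G(2)] by simp
    show "capp (t *\<^sub>R A) w \<in> G \<times> G \<times> UNIV" if "w \<in> G \<times> G \<times> UNIV" for w
      using that
      by (auto simp: A_def capp.scaleR_left x G(3) intro!: subspace_scale[OF G(2)] subspace_neg[OF G(2)])
  qed
  have mem: "c t \<in> G" "s t \<in> G" for t
    using v[of t] by (auto simp: c_def s_def)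
  have v': "(v has_vector_derivative capp (A * exp (t *\<^sub>R A)) (unit, 0, 0)) (at t)" for t
    unfolding v_def
    by (rule bounded_linear.has_vector_derivative[OF capp.bounded_linear_left exp_scaleR_has_vector_derivative])
  have cA: "capp (A * exp (t *\<^sub>R A)) (unit, 0, 0) = (- (x \<star> s t), x \<star> c t, 0)" for t
    by (cases "v t" rule: prod_cases3) (simp add: v_def c_def s_def A_def)
  have c': "(c has_vector_derivative - (x \<star> s t)) (at t)" for t
    using bounded_linear.has_vector_derivative[OF bounded_linear_fst v', of t]
    unfolding cA c_def[abs_def] by simp
  have s': "(s has_vector_derivative x \<star> c t) (at t)" for t
    using bounded_linear.has_vector_derivative[OF bounded_linear_fst
      bounded_linear.has_vector_derivative[OF bounded_linear_snd v'], of t]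
    unfolding cA s_def[abs_def] by simp
  have init: "c 0 = unit" "s 0 = 0"
    by (simp_all add: c_def s_def v_def)
  have cs: "c t \<star> (x \<star> s t) = s t \<star> (x \<star> c t)" for t
  proof -
    have "capp (mop (c t) * mop (s t)) (x, 0, 0) = capp (mop (s t) * mop (c t)) (x, 0, 0)"
      by (simp only: commute[OF mem(1)[of t] mem(2)[of t]])
    then show ?thesis
      by (simp add: jmult_commute[of x "s t"] jmult_commute[of x "c t"])
  qed
  have "((\<lambda>t. c t \<star> c t + s t \<star> s t) has_vector_derivative 0) (at t)" for t
    using has_vector_derivative_add[OF jmult.has_vector_derivative[OF c' c'] jmult.has_vector_derivative[OF s' s'], of t]
    by (rule has_vector_derivative_eq_rhs)
      (use cs[of t] in \<open>simp add: jmult_simps jmult_commute[of "x \<star> s t" "c t"] jmult_commute[of "x \<star> c t" "s t"]\<close>)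
  from vector_derivative_zero_constant[of "\<lambda>t. c t \<star> c t + s t \<star> s t", OF this]
  have pyth: "c t \<star> c t + s t \<star> s t = unit" for t
    by (simp add: init unit_left jmult_simps)
  have "(norm (c t))\<^sup>2 \<le> 1" "(norm (s t))\<^sup>2 \<le> 1" for t
    using norm_square_le_add[of "c t" "s t"] norm_square_le_add[of "s t" "c t"] norm_unit_le pyth[of t]
    by (simp_all add: norm_square add.commute)
  then have norm_cs: "norm (c t) \<le> 1" "norm (s t) \<le> 1" for t
    by (simp_all add: power_le_one_iff)
  \<comment> \<open>The quadratic operator 2 T_u T_u - T_{u*u} for u = c + is, split into real and
    imaginary parts.\<close>
  define R where "R t = 2 *\<^sub>R (mop (c t) * mop (c t)) - mop (c t \<star> c t)
      - (2 *\<^sub>R (mop (s t) * mop (s t)) - mop (s t \<star> s t))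
      + imag_cop * (4 *\<^sub>R (mop (c t) * mop (s t)) - 2 *\<^sub>R mop (c t \<star> s t))" for t
  have R': "(R has_vector_derivative (2 *\<^sub>R A) * R t) (at t)" for t
  proof -
    note mop' = bounded_linear.has_vector_derivative[OF bounded_linear_mop]
    note rules = mop'[OF c'] mop'[OF s'] mop'[OF jmult.has_vector_derivative[OF c' c']]
      mop'[OF jmult.has_vector_derivative[OF s' s']] mop'[OF jmult.has_vector_derivative[OF c' s']]
    have D: "(R has_vector_derivative
        2 *\<^sub>R (mop (c t) * mop (- (x \<star> s t)) + mop (- (x \<star> s t)) * mop (c t))
          - mop (c t \<star> - (x \<star> s t) + - (x \<star> s t) \<star> c t)
        - (2 *\<^sub>R (mop (s t) * mop (x \<star> c t) + mop (x \<star> c t) * mop (s t))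
          - mop (s t \<star> (x \<star> c t) + (x \<star> c t) \<star> s t))
        + imag_cop * (4 *\<^sub>R (mop (c t) * mop (x \<star> c t) + mop (- (x \<star> s t)) * mop (s t))
          - 2 *\<^sub>R mop (c t \<star> (x \<star> c t) + - (x \<star> s t) \<star> s t))) (at t)"
      unfolding R_def[abs_def]
      by (intro has_vector_derivative_add has_vector_derivative_diff has_vector_derivative_mult
        bounded_linear.has_vector_derivative[OF bounded_linear_mult_right]
        bounded_linear.has_vector_derivative[OF bounded_linear_scaleR_right] rules)
    have in_G: "c t \<in> G" "s t \<in> G" "x \<star> c t \<in> G" "x \<star> s t \<in> G" "c t \<star> c t \<in> G" "s t \<star> s t \<in> G"
      "c t \<star> s t \<in> G"
      by (simp_all add: mem x G(3))
    show ?thesis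
      using D
      by (rule has_vector_derivative_eq_rhs)
        (simp add: R_def A_def jmult_simps mop_add mop_diff mop_minus
          mop_triple[of x "c t" "c t"] mop_triple[of x "s t" "s t"]
          mop_triple[of x "c t" "s t"] mop_triple[of x "s t" "c t"]
          jmult_commute[of "c t" "x \<star> c t"] jmult_commute[of "c t" "x \<star> s t"]
          jmult_commute[of "s t" "x \<star> c t"] jmult_commute[of "s t" "x \<star> s t"] jmult_commute[of "s t" "c t"]
          scaleR_numerals imag_mop commute left_commute in_G x algebra_simps)
  qed
  let ?G = "\<lambda>t. exp (t *\<^sub>R - (2 *\<^sub>R A)) * R t"
  have "(?G has_vector_derivative 0) (at t)" for t
    using has_vector_derivative_mult[OF exp_scaleR_has_vector_derivative_right[of "- (2 *\<^sub>R A)"] R']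
    by (rule has_vector_derivative_eq_rhs) (simp add: mult.assoc)
  \<comment> \<open>\<open>R\<close> solves R' = 2 A R, so the exponential at t corresponds to
    \<open>R\<close> at t/2.\<close>
  from vector_derivative_zero_constant[of ?G, OF this, of "t / 2"]
  have "exp (- (t *\<^sub>R A)) * R (t / 2) = R 0"
    by simp
  also have "R 0 = mop unit"
    by (simp add: R_def init unit_left jmult_simps)
      (rule cop_eqI, simp add: capp_mop_eq capp.diff_left capp.add_left unit_left scaleR_2)
  finally have "exp (t *\<^sub>R A) * exp (- (t *\<^sub>R A)) * R (t / 2) = exp (t *\<^sub>R A) * mop unit"
    by (simp add: mult.assoc)
  then have "exp (t *\<^sub>R A) * mop unit = R (t / 2)"
    by (simp add: exp_minus_inverse)
  also have "norm (R (t / 2)) \<le> 12"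
  proof -
    let ?c = "c (t / 2)" and ?s = "s (t / 2)"
    have m: "norm (mop y * mop z) \<le> 1" "norm (mop (y \<star> z)) \<le> 1" if "norm y \<le> 1" "norm z \<le> 1" for y z
    proof -
      have "norm y * norm z \<le> 1"
        using that by (simp add: mult_le_one)
      moreover have "norm (mop y * mop z) \<le> norm y * norm z"
        by (rule order_trans[OF norm_mult_ineq]) (intro mult_mono norm_mop_le norm_ge_zero)
      moreover have "norm (mop (y \<star> z)) \<le> norm y * norm z"
        by (rule order_trans[OF norm_mop_le norm_jmult_le])
      ultimately show "norm (mop y * mop z) \<le> 1" "norm (mop (y \<star> z)) \<le> 1" by simp_all
    qed
    have d: "norm (X - Y) \<le> p + q" if "norm X \<le> p" "norm Y \<le> q" for X Y :: "'a cop" and p q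
      using that norm_triangle_ineq4[of X Y] by linarith
    have r: "norm (k *\<^sub>R X) \<le> k" if "norm X \<le> 1" "0 \<le> k" for X :: "'a cop" and k
      using that by (simp add: mult_left_le)
    have i: "norm (imag_cop * X) \<le> p" if "norm X \<le> p" for X :: "'a cop" and p
    proof -
      have "norm (imag_cop * X) \<le> 1 * norm X"
        by (rule order_trans[OF norm_mult_ineq mult_right_mono[OF norm_imag_le norm_ge_zero]])
      then show ?thesis
        using that by simp
    qed
    \<comment> \<open>The sum of the absolute values of the coefficients of \<open>R\<close>: 2 + 1
      for each of c and s, and 4 + 2 for the imaginary part.\<close>
    have "norm (R (t / 2)) \<le> ((2 + 1) + (2 + 1)) + (4 + 2)"
      unfolding R_def by (intro norm_triangle_le add_mono d r i m norm_cs) simp_all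
    then show ?thesis by simp
  qed
  finally show ?thesis
    by (simp add: A_def)
qed

end


subsection \<open>A Liouville theorem for exponentials\<close>

text \<open>Real and imaginary parts of a geometric sum over the powers of an m-th root of unity,
  which differs from 1 because m does not divide k.\<close>

lemma sum_roots_of_unity_trig:
  fixes m k :: nat
  assumes "0 < k" "k < m"
  shows "(\<Sum>j<m. cos (real k * (2 * pi * real j / real m))) = 0"
    and "(\<Sum>j<m. sin (real k * (2 * pi * real j / real m))) = 0"
proof -
  define w where "w = cis (2 * pi * real k / real m)"
  have "w \<noteq> 1"
  proof
    assume "w = 1"
    then have "cos (2 * pi * real k / real m) = 1"
      by (simp add: w_def complex_eq_iff)
    then obtain n :: int where "2 * pi * real k / real m = of_int n * 2 * pi"
      using cos_one_2pi_int by auto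
    then have "real k = of_int n * real m"
      using assms by (simp add: field_simps)
    then have k: "int k = n * int m"
      by (metis of_int_mult of_int_of_nat_eq of_int_eq_iff)
    then have "0 < n"
      using assms by (metis of_nat_0_less_iff zero_less_mult_pos2 less_trans)
    then have "int m \<le> n * int m"
      using mult_right_mono[of 1 n "int m"] by simp
    then show False
      using k assms by linarith
  qed
  moreover have "w ^ m = 1"
  proof -
    have "w ^ m = cis (real m * (2 * pi * real k / real m))"
      unfolding w_def by (rule Complex.DeMoivre)
    also have "real m * (2 * pi * real k / real m) = 2 * pi * real k"
      using assms by simp
    finally show ?thesis
      by (simp add: cis_multiple_2pi)
  qed
  ultimately have "(\<Sum>j<m. w ^ j) = 0"
    by (simp add: geometric_sum)
  moreover have "w ^ j = cis (real k * (2 * pi * real j / real m))" for j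
    by (simp add: w_def Complex.DeMoivre mult.commute mult.left_commute)
  ultimately have *: "(\<Sum>j<m. cis (real k * (2 * pi * real j / real m))) = 0"
    by simp
  show "(\<Sum>j<m. cos (real k * (2 * pi * real j / real m))) = 0"
    using arg_cong[OF *, of Re] by simp
  show "(\<Sum>j<m. sin (real k * (2 * pi * real j / real m))) = 0"
    using arg_cong[OF *, of Im] by simp
qed

text \<open>The tail of the operator series is dominated term by term by the tail of the scalar
  series.\<close>

lemma norm_exp_minus_partial_sum_le:
  fixes X :: "'a::{real_normed_algebra_1,banach}"
  assumes "norm X \<le> y"
  shows "norm (exp X - (\<Sum>n<m. X ^ n /\<^sub>R fact n)) \<le> exp y - (\<Sum>n<m. y ^ n /\<^sub>R fact n)"
proof -
  have le: "norm (X ^ n /\<^sub>R fact n) \<le> y ^ n /\<^sub>R fact n" for n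
    using order_trans[OF norm_power_ineq power_mono[OF assms norm_ge_zero]]
    by (simp add: divide_right_mono field_simps)
  have "exp X - (\<Sum>n<m. X ^ n /\<^sub>R fact n) = (\<Sum>n. X ^ (n + m) /\<^sub>R fact (n + m))"
    unfolding exp_def by (subst suminf_minus_initial_segment[OF summable_exp_generic]) simp
  also have "norm \<dots> \<le> (\<Sum>n. y ^ (n + m) /\<^sub>R fact (n + m))"
    by (rule norm_suminf_le[OF le summable_ignore_initial_segment[OF summable_exp_generic]])
  also have "\<dots> = exp y - (\<Sum>n<m. y ^ n /\<^sub>R fact n)"
    unfolding exp_def by (subst suminf_minus_initial_segment[OF summable_exp_generic]) simp
  finally show ?thesis .
qed

text \<open>Averaging \<open>exp (r \<cdot> \<zeta> \<cdot> K) / \<zeta>\<close> over the \<open>m\<close>-th roots of unity \<open>\<zeta>\<close>, with \<open>J\<close> as imaginary unit, leaves the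
  linear Taylor coefficient \<open>r \<cdot> K\<close> up to an error that tends to 0 as \<open>m\<close> grows.\<close>

lemma exp_bounded_imp_zero:
  fixes K J Z :: "'a::{real_normed_algebra_1,banach}"
  assumes JK: "K * J = J * K" "J * (J * K) = - K"
    and bound: "\<And>s t. norm (exp (s *\<^sub>R K + t *\<^sub>R (J * K)) * Z) \<le> M"
  shows "K * Z = 0"
proof -
  \<comment> \<open>\<open>z\<close> plays the role of exp(i\<theta>). As J squares to -1 only on
    left multiples of K, the addition law \<open>zz\<close> carries a factor K.\<close>
  define z where "z \<theta> = cos \<theta> *\<^sub>R 1 + sin \<theta> *\<^sub>R J" for \<theta>
  have Kz: "K * z \<theta> = z \<theta> * K" for \<theta>
    by (simp add: z_def JK algebra_simps)
  have zz: "z \<theta> * (z \<phi> * (K * W)) = z (\<theta> + \<phi>) * (K * W)" for \<theta> \<phi> W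
  proof -
    have "J * (J * (K * W)) = - (K * W)"
      using JK(2) by (metis mult.assoc mult_minus_left)
    then show ?thesis
      by (simp add: z_def cos_add sin_add algebra_simps)
  qed
  have pow: "(z \<theta> * K) ^ Suc n = z (real (Suc n) * \<theta>) * K ^ Suc n" for \<theta> n
  proof (induction n)
    case (Suc n)
    have "(z \<theta> * K) ^ Suc (Suc n) = z \<theta> * (K * z (real (Suc n) * \<theta>)) * K ^ Suc n"
      by (subst power_Suc) (simp only: Suc mult.assoc)
    also have "\<dots> = z \<theta> * (z (real (Suc n) * \<theta>) * (K * K ^ Suc n))"
      by (simp only: Kz mult.assoc)
    also have "\<dots> = z (real (Suc (Suc n)) * \<theta>) * K ^ Suc (Suc n)"
      by (simp only: zz) (simp add: algebra_simps)
    finally show ?case .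
  qed (simp add: z_def)
  have z_norm: "norm (z \<theta>) \<le> 1 + norm J" for \<theta>
    unfolding z_def
    by (intro norm_triangle_le add_mono) (simp_all add: mult_left_le_one_le)
  have pos: "norm (r *\<^sub>R (K * Z)) \<le> (1 + norm J) * M" if "0 < r" for r
  proof -
    define y where "y = r * ((1 + norm J) * norm K)"
    define \<tau> where "\<tau> m = exp y - (\<Sum>n<m. y ^ n /\<^sub>R fact n)" for m
    have "(\<lambda>m. \<Sum>n<m. y ^ n /\<^sub>R fact n) \<longlonglongrightarrow> exp y"
      unfolding exp_def using summable_sums[OF summable_exp_generic] sums_def by blast
    from tendsto_diff[OF tendsto_const[of "exp y"] this] have "\<tau> \<longlonglongrightarrow> 0"
      unfolding \<tau>_def[abs_def] by simp
    then have "(\<lambda>m. (1 + norm J) * (M + \<tau> m * norm Z)) \<longlonglongrightarrow> (1 + norm J) * (M + 0 * norm Z)"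
      by (intro tendsto_intros)
    \<comment> \<open>At least two roots are needed: the linear coefficient must be among the n < m,
      and the roots must sum to 0.\<close>
    moreover have "norm (r *\<^sub>R (K * Z)) \<le> (1 + norm J) * (M + \<tau> m * norm Z)" if m: "2 \<le> m" for m
    proof -
      define \<theta> where "\<theta> j = 2 * pi * real j / real m" for j :: nat
      define X where "X j = r *\<^sub>R (z (\<theta> j) * K)" for j
      define S where "S j = (\<Sum>n<m. X j ^ n /\<^sub>R fact n)" for j
      have sum_z: "(\<Sum>j<m. z (real k * \<theta> j)) = 0" if "0 < k" "k < m" for k
        using sum_roots_of_unity_trig[OF that]
        by (simp add: z_def \<theta>_def sum.distrib flip: scaleR_sum_left)
      have sum_z': "(\<Sum>j<m. z (- \<theta> j)) = 0"
        using sum_roots_of_unity_trig[of 1 m] m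
        by (simp add: z_def \<theta>_def sum_subtractf flip: scaleR_sum_left)
      \<comment> \<open>For n = p + 1 the factor \<open>z (- \<theta> j)\<close> leaves the angle p
        times \<open>\<theta> j\<close>, so averaging kills every such term except p = 0; for n = 0
        the inverse roots sum to 0.\<close>
      have avg: "(\<Sum>j<m. z (- \<theta> j) * (X j ^ n /\<^sub>R fact n)) = (if n = 1 then real m *\<^sub>R r *\<^sub>R K else 0)"
        if "n < m" for n
      proof (cases n)
        case 0
        then show ?thesis
          using sum_z' by simp
      next
        case (Suc p)
        have "z (- \<theta> j) * (X j ^ n /\<^sub>R fact n) = (r ^ n / fact n) *\<^sub>R (z (real p * \<theta> j) * K ^ n)" for j
        proof -
          have "z (- \<theta> j) * (z (real (Suc p) * \<theta> j) * (K * K ^ p)) = z (real p * \<theta> j) * (K * K ^ p)"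
            by (simp only: zz) (simp add: algebra_simps)
          then show ?thesis
            unfolding X_def Suc scaleR_power pow by (simp add: field_simps)
        qed
        then have "(\<Sum>j<m. z (- \<theta> j) * (X j ^ n /\<^sub>R fact n)) = (r ^ n / fact n) *\<^sub>R ((\<Sum>j<m. z (real p * \<theta> j)) * K ^ n)"
          by (simp add: sum_distrib_right flip: scaleR_sum_right)
        also have "\<dots> = (if n = 1 then real m *\<^sub>R r *\<^sub>R K else 0)"
        proof (cases "p = 0")
          case True
          then have "(\<Sum>j<m. z (real p * \<theta> j)) = real m *\<^sub>R 1"
            by (simp add: z_def scaleR_conv_of_real)
          with True show ?thesis
            using Suc by (simp add: mult.commute del: sum_constant)
        next
          case False
          then show ?thesis
            using sum_z[of p] that Suc by simp
        qed
        finally show ?thesis .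
      qed
      have "(\<Sum>j<m. z (- \<theta> j) * S j) = (\<Sum>n<m. \<Sum>j<m. z (- \<theta> j) * (X j ^ n /\<^sub>R fact n))"
        unfolding S_def sum_distrib_left by (rule sum.swap)
      also have "\<dots> = real m *\<^sub>R r *\<^sub>R K"
        using m by (subst sum.cong[OF refl avg]) simp_all
      finally have "real m *\<^sub>R (r *\<^sub>R (K * Z)) = (\<Sum>j<m. z (- \<theta> j) * (S j * Z))"
        by (metis (no_types, lifting) sum_distrib_right mult.assoc mult_scaleR_left sum.cong)
      also have "norm \<dots> \<le> (\<Sum>j<m. (1 + norm J) * (M + \<tau> m * norm Z))"
      proof (rule sum_norm_le)
        fix j
        have "norm (z (\<theta> j) * K) \<le> (1 + norm J) * norm K"
          by (rule order_trans[OF norm_mult_ineq mult_right_mono[OF z_norm norm_ge_zero]])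
        then have "norm (X j) \<le> y"
          using \<open>0 < r\<close> by (simp add: X_def y_def mult_left_mono)
        then have "norm (exp (X j) - S j) \<le> \<tau> m"
          unfolding S_def \<tau>_def by (rule norm_exp_minus_partial_sum_le)
        then have "norm ((exp (X j) - S j) * Z) \<le> \<tau> m * norm Z"
          by (rule order_trans[OF norm_mult_ineq mult_right_mono[OF _ norm_ge_zero]])
        moreover have "X j = (r * cos (\<theta> j)) *\<^sub>R K + (r * sin (\<theta> j)) *\<^sub>R (J * K)"
          by (simp add: X_def z_def algebra_simps)
        then have "norm (exp (X j) * Z) \<le> M"
          using bound by simp
        moreover have "S j * Z = exp (X j) * Z - (exp (X j) - S j) * Z"
          by (simp add: algebra_simps)
        ultimately have "norm (S j * Z) \<le> M + \<tau> m * norm Z"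
          using norm_triangle_ineq4[of "exp (X j) * Z" "(exp (X j) - S j) * Z"] by simp
        then show "norm (z (- \<theta> j) * (S j * Z)) \<le> (1 + norm J) * (M + \<tau> m * norm Z)"
          by (rule order_trans[OF norm_mult_ineq mult_mono[OF z_norm]]) simp_all
      qed
      finally show ?thesis
        using m by (simp add: abs_mult mult.assoc)
    qed
    ultimately show ?thesis
      using LIMSEQ_le_const[of "\<lambda>m. (1 + norm J) * (M + \<tau> m * norm Z)"] by auto
  qed
  have "norm (0 + r *\<^sub>R (K * Z)) \<le> (1 + norm J) * M" for r
  proof (cases "r = 0")
    case True
    then show ?thesis
      using order_trans[OF norm_ge_zero pos[of 1]] by simp
  next
    case False
    then show ?thesis
      using pos[of "\<bar>r\<bar>"] by simp
  qed
  then show ?thesis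
    by (rule linear_bounded_imp_zero)
qed


subsection \<open>The positive case\<close>

context jb_algebra
begin

definition qop :: "'a \<Rightarrow> 'a cop"
  where "qop e = 2 *\<^sub>R (mop e * mop e) - mop (e \<star> e)"

text \<open>In an associative algebra with the symmetrized product, both sides send z to half of
  e(gz + zg)e with g = ebe. In general it is verified by normalizing words in multiplication
  operators.\<close>

lemma qop_intertwine:
  "(mop ((e \<star> e) \<star> b) + dop (e \<star> e) b) * qop e = qop e * mop (2 *\<^sub>R (e \<star> (e \<star> b)) - (e \<star> e) \<star> b)"
proof -
  define L M B N where "L = mop e" and "M = mop (e \<star> e)" and "B = mop b" and "N = 2 *\<^sub>R mop (e \<star> b)"
  \<comment> \<open>\<open>LM\<close>, \<open>NL\<close> and \<open>NM\<close> serve as rewrite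
    rules that put L before M and move N to the right past both.\<close>
  have LM: "M * L = L * M" "M * (L * Z) = L * (M * Z)" for Z
    using mop_square_commute[of e] by (simp_all add: L_def M_def flip: mult.assoc)
  have NL: "N * L = L * N + B * M - M * B"
    using dop_square[of b e]
    by (simp add: N_def L_def B_def M_def dop_def comm_def scaleR_2 algebra_simps)
  have e2b: "mop ((e \<star> e) \<star> b) = L * N + B * M - (L * (B * L) + L * (B * L))"
    using mop_triple[of e e b] by (simp add: N_def L_def B_def M_def scaleR_2 algebra_simps)
  have e3: "mop ((e \<star> e) \<star> e) = L * M + L * M + L * M - (L * (L * L) + L * (L * L))"
    using mop_triple[of e e e] by (simp add: L_def M_def algebra_simps)
  have eeb: "mop ((e \<star> b) \<star> e) = L * N + B * M - L * (L * B) - B * (L * L)"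
    using mop_triple[of e b e]
    by (simp add: N_def L_def B_def M_def jmult_commute[of b e] scaleR_2 algebra_simps)
  have "comm M N = - 2 *\<^sub>R (comm L (mop ((e \<star> e) \<star> b)) + comm B (mop ((e \<star> e) \<star> e)))"
    using mop_linearized[of "e \<star> e" e b]
    by (simp add: M_def N_def L_def B_def comm_scaleR jmult_commute[of b "e \<star> e"] add.assoc
      eq_neg_iff_add_eq_0 flip: scaleR_add_right)
  then have NM: "N * M = M * N + 2 *\<^sub>R (comm L (mop ((e \<star> e) \<star> b)) + comm B (mop ((e \<star> e) \<star> e)))"
    by (simp add: comm_def[of M N] algebra_simps)
  have NL': "N * (L * Z) = L * (N * Z) + B * (M * Z) - M * (B * Z)" for Z
    using NL by (metis (no_types, lifting) distrib_right left_diff_distrib mult.assoc)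
  have "dop (e \<star> e) b = M * B - B * M"
    by (simp add: dop_def comm_def M_def B_def)
  moreover have "mop (2 *\<^sub>R (e \<star> (e \<star> b)) - (e \<star> e) \<star> b) = 2 *\<^sub>R mop ((e \<star> b) \<star> e) - mop ((e \<star> e) \<star> b)"
    by (simp add: mop_diff mop_scaleR jmult_commute[of e "e \<star> b"])
  moreover have "qop e = L * L + L * L - M"
    by (simp add: qop_def L_def M_def scaleR_2)
  ultimately show ?thesis
    by (simp add: e2b eeb)
      (simp add: NM e2b e3 comm_def scaleR_numerals NL NL' LM algebra_simps)
qed

lemma norm_exp_dop_le: "norm (exp (t *\<^sub>R dop a b) * mop unit) \<le> 1"
proof (rule norm_cop_bound)
  fix v :: "'a \<times> 'a \<times> real"
  obtain x y r where v: "v = (x, y, r)"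
    by (metis prod_cases3)
  have "(norm (der_flow a b t x))\<^sup>2 + (norm (der_flow a b t y))\<^sup>2 \<le> (norm x)\<^sup>2 + ((norm y)\<^sup>2 + r\<^sup>2)"
    using power_mono[OF norm_der_flow_le[of a b t x] norm_ge_zero, of 2]
      power_mono[OF norm_der_flow_le[of a b t y] norm_ge_zero, of 2]
    by (simp add: add_increasing2 add_mono)
  then show "norm (capp (exp (t *\<^sub>R dop a b) * mop unit) v) \<le> 1 * norm v"
    by (simp add: v capp_exp_dop unit_left norm_Pair)
qed simp

text \<open>The growth argument for nilpotent derivations applies to i T_a, whose exponential is
  bounded by \<open>norm_exp_imag_mop\<close>.\<close>

lemma jmult_square_eq_0_imp: "a \<star> u = 0" if "a \<star> (a \<star> u) = 0"
proof -
  have "capp (imag_cop * mop a) (u, 0, 0) = 0"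
  proof (rule capp_nilpotent_imp_zero)
    show "capp (imag_cop * mop a) (capp (imag_cop * mop a) (u, 0, 0)) = 0"
      using that by (simp add: jmult_simps zero_prod_def)
    have "capp (exp (t *\<^sub>R (imag_cop * mop a))) (u, 0, 0)
        = capp (exp (t *\<^sub>R (imag_cop * mop a)) * mop unit) (u, 0, 0)" for t
      by (simp add: unit_left)
    then show "norm (capp (exp (t *\<^sub>R (imag_cop * mop a))) (u, 0, 0)) \<le> 12 * norm (u, 0 :: 'a, 0 :: real)" for t
      using order_trans[OF norm_capp mult_right_mono[OF norm_exp_imag_mop norm_ge_zero]] by metis
  qed
  then show ?thesis
    by (simp add: zero_prod_def jmult_simps)
qed

lemma dop_qop_eq_0:
  assumes "inner_der (e \<star> e) b ((e \<star> e) \<star> b) = 0"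
  shows "dop (e \<star> e) b * qop e = 0"
proof -
  define K H Q G where "K = dop (e \<star> e) b" and "H = mop ((e \<star> e) \<star> b)" and "Q = qop e"
    and "G = mop (2 *\<^sub>R (e \<star> (e \<star> b)) - (e \<star> e) \<star> b)"
  have KH: "K * H = H * K"
    using assms comm_dop_eq_0 by (simp add: K_def H_def comm_eq_0_iff)
  have unit: "mop unit * mop x = mop x" "mop x * mop unit = mop x" "mop unit * (mop x * Z) = mop x * Z" for x Z
  proof -
    show "mop unit * mop x = mop x" and *: "mop x * mop unit = mop x"
      by (rule cop_eqI, simp add: capp_mop_eq unit_left)+
    then show "mop unit * (mop x * Z) = mop x * Z"
      by (simp flip: mult.assoc)
  qed
  have imag: "K * imag_cop = imag_cop * K" "imag_cop * (imag_cop * K) = - K" "Q * imag_cop = imag_cop * Q"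
    by (simp_all add: K_def Q_def qop_def dop_def comm_def imag_mop algebra_simps)
  have KU: "K * mop unit = mop unit * K" "mop unit * Q = Q" "Q * mop unit = Q"
    by (simp_all add: K_def Q_def qop_def dop_def comm_def unit mult.assoc algebra_simps)
  \<comment> \<open>K annihilates (e * e) * b, so H and K commute and exp(it(H + K)) splits.
    Intertwining with Q then gives exp(itK) Q = exp(-itH) Q exp(itG).\<close>
  have bound_imag: "norm (exp (t *\<^sub>R (imag_cop * K)) * Q) \<le> 12 * norm Q * 12" for t
  proof -
    let ?H = "t *\<^sub>R (imag_cop * H)" and ?K = "t *\<^sub>R (imag_cop * K)" and ?G = "t *\<^sub>R (imag_cop * G)"
    have "(H + K) * Q = Q * G"
      unfolding H_def K_def Q_def G_def by (rule qop_intertwine)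
    then have "imag_cop * ((H + K) * Q) = Q * (imag_cop * G)"
      by (simp add: imag flip: mult.assoc)
    then have "(t *\<^sub>R (imag_cop * (H + K))) * Q = Q * (t *\<^sub>R (imag_cop * G))"
      by (simp add: mult.assoc)
    then have "exp (?H + ?K) * Q = Q * exp ?G"
      by (intro exp_intertwine) (simp add: distrib_left scaleR_add_right)
    moreover have "?H * ?K = ?K * ?H"
    proof -
      have "H * imag_cop = imag_cop * H"
        by (simp add: H_def imag_mop)
      then have "imag_cop * H * (imag_cop * K) = imag_cop * K * (imag_cop * H)"
        using KH imag(1) by (metis mult.assoc)
      then show ?thesis by simp
    qed
    ultimately have "exp ?H * (exp ?K * Q) = Q * exp ?G"
      by (simp add: exp_add_commuting mult.assoc)
    then have "exp (- ?H) * exp ?H * (exp ?K * Q) = exp (- ?H) * (Q * exp ?G)"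
      by (simp add: mult.assoc)
    then have *: "exp ?K * Q = exp (- ?H) * (Q * exp ?G)"
      using exp_minus_inverse[of "- ?H"] by simp
    have "exp ?G * mop unit = mop unit * exp ?G"
      by (rule exp_intertwine) (simp add: G_def imag_mop unit mult.assoc)
    \<comment> \<open>The projection \<open>mop unit\<close> is absorbed by Q and commutes with the
      right exponential; inserting it brings both outer factors into the form bounded by
      \<open>norm_exp_imag_mop\<close>.\<close>
    then have "exp ?K * Q = (exp (- ?H) * mop unit) * Q * (exp ?G * mop unit)"
      using * KU by (metis mult.assoc)
    also have "norm \<dots> \<le> 12 * norm Q * 12"
    proof -
      have H: "norm (exp (- ?H) * mop unit) \<le> 12" and G: "norm (exp ?G * mop unit) \<le> 12"
        using norm_exp_imag_mop[of "- t"] norm_exp_imag_mop[of t] by (simp_all add: H_def G_def)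
      show ?thesis
        by (rule order_trans[OF norm_mult_ineq mult_mono[OF order_trans[OF norm_mult_ineq
            mult_right_mono[OF H norm_ge_zero]] G]]; simp)
    qed
    finally show ?thesis .
  qed
  have "norm (exp (s *\<^sub>R K + t *\<^sub>R (imag_cop * K)) * Q) \<le> 12 * norm Q * 12" for s t
  proof -
    have "s *\<^sub>R K * t *\<^sub>R (imag_cop * K) = t *\<^sub>R (imag_cop * K) * s *\<^sub>R K"
      by (simp add: mult.assoc flip: imag(1))
    then have "exp (s *\<^sub>R K + t *\<^sub>R (imag_cop * K)) * Q
        = exp (s *\<^sub>R K) * (exp (t *\<^sub>R (imag_cop * K)) * mop unit) * Q"
      by (simp add: exp_add_commuting KU mult.assoc)
    also have "exp (t *\<^sub>R (imag_cop * K)) * mop unit = mop unit * exp (t *\<^sub>R (imag_cop * K))"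
      by (rule exp_intertwine) (simp add: KU imag_mop mult.assoc)
    also have "exp (s *\<^sub>R K) * (mop unit * exp (t *\<^sub>R (imag_cop * K))) * Q
        = (exp (s *\<^sub>R K) * mop unit) * (exp (t *\<^sub>R (imag_cop * K)) * Q)"
      by (simp only: mult.assoc)
    also have "norm \<dots> \<le> 1 * (12 * norm Q * 12)"
      by (rule order_trans[OF norm_mult_ineq mult_mono[OF _ bound_imag]])
        (simp_all add: K_def norm_exp_dop_le)
    finally show ?thesis by simp
  qed
  then have "K * Q = 0"
    by (rule exp_bounded_imp_zero[OF imag(1,2)])
  then show ?thesis
    by (simp add: K_def Q_def)
qed

lemma positive_commute:
  assumes "inner_der a b (a \<star> b) = 0" and "a = e \<star> e"
  shows "dop a b = 0"
proof -
  \<comment> \<open>Q_e maps the unit to e * e = a, so evaluation at the unit yields K a =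
    0.\<close>
  have "capp (dop a b * qop e) (unit, 0, 0) = 0"
    using dop_qop_eq_0[of e b] assms by (simp add: capp.zero_left)
  then have a: "inner_der a b a = 0"
    by (simp add: qop_def capp.diff_left capp.add_left unit_right assms(2)[symmetric] jmult_simps
      scaleR_2 zero_prod_def)
  define c where "c = inner_der a b b"
  have ac: "a \<star> c = 0"
    using assms(1) by (simp add: inner_der_mult a jmult_simps c_def)
  then have c: "inner_der a b c = a \<star> (b \<star> c)"
    by (simp add: inner_der_def jmult_simps)
  \<comment> \<open>K commutes with T_a because K a = 0. As K c = a * (b * c), this gives T_a T_a (b
    * c) = 0, and \<open>jmult_square_eq_0_imp\<close> removes one factor T_a.\<close>
  have "a \<star> inner_der a b c = inner_der a b (a \<star> c)"
    by (simp add: inner_der_mult a jmult_simps)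
  then have "a \<star> (a \<star> (b \<star> c)) = 0"
    by (simp add: ac c inner_der_simps)
  then have "inner_der a b c = 0"
    unfolding c by (rule jmult_square_eq_0_imp)
  then have "inner_der a b b = 0"
    unfolding c_def by (rule inner_der_nilpotent)
  with a show ?thesis
    by (rule dop_eq_0(1))
qed

lemma jordan_Q_eq_iff: "jordan_Q (\<star>) a (b \<star> b) = jordan_Q (\<star>) b (a \<star> a) \<longleftrightarrow> inner_der a b (a \<star> b) = 0"
proof -
  have "jordan_Q (\<star>) a (b \<star> b) - jordan_Q (\<star>) b (a \<star> a) = 4 *\<^sub>R inner_der a b (a \<star> b)"
    using inner_der_product[of a b]
    by (simp add: jordan_Q_def jordan_T_def jmult_commute[of "b \<star> b" "a \<star> a"] scaleR_numerals)
  then show ?thesis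
    by (metis eq_iff_diff_eq_0 scaleR_eq_0_iff zero_neq_numeral)
qed

lemma positive_commute_iff:
  assumes "jordan_positive (\<star>) a \<or> jordan_positive (\<star>) b"
  shows "dop a b = 0 \<longleftrightarrow> jordan_Q (\<star>) a (b \<star> b) = jordan_Q (\<star>) b (a \<star> a)"
  unfolding jordan_Q_eq_iff
proof
  assume *: "inner_der a b (a \<star> b) = 0"
  then have "inner_der b a (b \<star> a) = 0"
    by (simp add: inner_der_swap[of b a] jmult_commute[of b a])
  with * assms have "dop a b = 0 \<or> dop b a = 0"
    unfolding jordan_positive_def using positive_commute by blast
  then show "dop a b = 0"
    by (auto simp: dop_swap[of b a])
qed (simp add: dop_eq_0_iff)

end

theorem theorem3p13:
  fixes jmult :: "'a::banach \<Rightarrow> 'a \<Rightarrow> 'a"  (infixl \<open>\<star>\<close> 70)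
    and unit :: 'a
    and a b :: 'a
  assumes "jb_algebra (\<star>) unit"
  shows "(operator_commute (\<star>) a b \<longleftrightarrow>
            associative_on (\<star>) (generated_jb_algebra (\<star>) unit a b))
       \<and> (operator_commute (\<star>) a b \<longleftrightarrow>
            associative_on (\<star>) (generated_jb_algebra (\<star>) unit a b) \<and>
            (\<forall>x\<in>generated_jb_algebra (\<star>) unit a b. \<forall>y\<in>generated_jb_algebra (\<star>) unit a b.
               operator_commute (\<star>) x y))
       \<and> (operator_commute (\<star>) a b \<longleftrightarrow>
            operator_commute (\<star>) a b \<and> operator_commute (\<star>) a (b \<star> b) \<and>
            operator_commute (\<star>) (a \<star> a) b \<and> operator_commute (\<star>) (a \<star> a) (b \<star> b))
       \<and> (jordan_positive (\<star>) a \<or> jordan_positive (\<star>) b \<longrightarrow>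
            (operator_commute (\<star>) a b \<longleftrightarrow> jordan_Q (\<star>) a (b \<star> b) = jordan_Q (\<star>) b (a \<star> a)))"
proof -
  interpret jb_algebra "(\<star>)" unit
    by fact
  let ?G = "generated_jb_algebra (\<star>) unit a b"
  have assoc: "dop a b = 0 \<longleftrightarrow> associative_on (\<star>) ?G"
    using associative_generated associative_generated_imp_commute by blast
  have commute: "dop x y = 0" if "dop a b = 0" "x \<in> ?G" "y \<in> ?G" for x y
    using that by (rule dop_generated_eq_0)
  have "a \<in> ?G" "b \<in> ?G"
    using generated_subset by auto
  moreover from this have "a \<star> a \<in> ?G" "b \<star> b \<in> ?G"
    using closed_jordan_subalgebra_generated[of a b] unfolding closed_jordan_subalgebra_def by auto
  ultimately show ?thesis
    unfolding dop_eq_0_iff_operator_commute[symmetric]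
    using assoc commute positive_commute_iff[of a b] by blast
qed

end
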